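(* Let $A\in\mathbb{K}_k^{n\times n}$ have a canonical set of eigenvalues $\lambda_1,\dots,\lambda_n$ where $|\lambda_1|>|\lambda_2|$. Then the power method in the circulant algebra converges to an eigenvector $x_1$ with eigenvalue $\lambda_1$.
   Context: Circulant algebra. $\mathbb{K}_k$ is the commutative ring of length-$k$ parameter tuples $\alpha=\{\alpha_1,\dots,\alpha_k\}$ (complex entries allowed), identified with the $k\times k$ circulant matrix $\mathrm{circ}(\alpha)$ whose first column is $(\alpha_1,\dots,\alpha_k)^T$; sum and product ($\circ$) are those of the circulant matrices, and $1=\{1,0,\dots,0\}$. $\mathbb{K}_k^n$ and $\mathbb{K}_k^{m\times n}$ are the vectors and matrices over this ring, with the usual matrix product, also written $\circ$; $I$ is the identity matrix over $\mathbb{K}_k$. Fourier coefficients. Let $F$ be the $k\times k$ unitary matrix with $F_{ij}=\omega^{(i-1)(j-1)}/\sqrt{k}$, $\omega=e^{2\pi \mathrm{i}/k}$. Put $\mathrm{cft}(\alpha)=F^*\mathrm{circ}(\alpha)F=\mathrm{diag}(\hat\alpha_1,\dots,\hat\alpha_k)$. For $A\in\mathbb{K}_k^{n\times n}$, $\mathrm{cft}(A)$ is the block-diagonal matrix with blocks $\hat A_1,\dots,\hat A_k\in\mathbb{C}^{n\times n}$, where the $(r,s)$ entry of $\hat A_j$ is the $j$-th diagonal entry of $\mathrm{cft}(A_{r,s})$; similarly $x\in\mathbb{K}_k^n$ has blocks $\hat x_1,\dots,\hat x_k\in\mathbb{C}^n$. Absolute value, angle and order. $|\alpha|=\mathrm{abs}(\alpha)\in\mathbb{K}_k$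 is the element with $\mathrm{cft}(\mathrm{abs}(\alpha))=\mathrm{diag}(|\hat\alpha_1|,\dots,|\hat\alpha_k|)$, and $\mathrm{angle}(\alpha)\in\mathbb{K}_k$ is the element with $\mathrm{cft}(\mathrm{angle}(\alpha))=\mathrm{diag}(\hat\alpha_1/|\hat\alpha_1|,\dots,\hat\alpha_k/|\hat\alpha_k|)$. $\alpha\le\beta$ (resp. $\alpha<\beta$) means $\hat\alpha_j\le\hat\beta_j$ (resp. $\hat\alpha_j<\hat\beta_j$) for all $j$. Eigenpairs. $\lambda\in\mathbb{K}_k$ is an eigenvalue of $A\in\mathbb{K}_k^{n\times n}$ if $\det(A-\lambda\circ I)=0$ in $\mathbb{K}_k$; a corresponding eigenvector is $x\in\mathbb{K}_k^n$ with $A\circ x=\lambda\circ x$ and $\hat x_j\neq 0$ for all $j$. Equivalently, $\hat A_j\hat x_j=\hat\lambda_j\hat x_j$ with $\hat x_j\neq0$ for every $j$. Canonical set. A canonical set of eigenvalues and eigenvectors of $A$ is a set of eigenvalues and corresponding eigenvectors of minimum size, ordered such that $\mathrm{abs}(\lambda_1)\ge\mathrm{abs}(\lambda_2)\ge\cdots$, which contains the information to reproduce any eigenvalue or eigenvector of $A$ (by recombining, for each $j$, the $j$-th Fourier components of members of the set). Norm. For $x\in\mathbb{K}_k^n$, $\|x\|\in\mathbb{K}_k$ is defined by $\mathrm{circ}(\|x\|)=\big(\sum_{i=1}^n\mathrm{circ}(x_i)^*\mathrm{circ}(x_i)\big)^{1/2}$; equivalently its $j$-th Fourier coefficient is the Euclidean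 norm of $\hat x_j$. Inverses of elements of $\mathbb{K}_k$ are ring inverses. Power method in the circulant algebra. Given $A$, a starting vector $x^{(0)}\in\mathbb{K}_k^n$ and a tolerance $\tau$: replace $x^{(0)}$ by $x^{(0)}\circ\|x^{(0)}\|^{-1}$; then for $t=1,2,\dots$ until convergence set $y^{(t)}=A\circ x^{(t-1)}$, $\alpha^{(t)}=\|y^{(t)}\|$, $x^{(t)}=y^{(t)}\circ(\alpha^{(t)})^{-1}$. Normalized eigenvectors are regarded as unique only up to a choice of angle (multiplication by an element $\beta\in\mathbb{K}_k$ with $\mathrm{circ}(\beta)$ orthogonal), and accordingly the convergence criterion is $\big\|\mathrm{angle}(x^{(t)}_1)^{-1}\circ x^{(t)}-\mathrm{angle}(x^{(t-1)}_1)^{-1}\circ x^{(t-1)}\big\|<\{\tau,0,\dots,0\}$, where $x^{(t)}_1$ denotes the first component of $x^{(t)}$.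
   Formalization: The start vector is assumed to have, in every Fourier block, a nonzero part in the generalized eigenspace of λ₁ (the claim fails otherwise); convergence is up to angle, and the first-component angle-fixed criterion is claimed only if that component of the limit is a unit. *)

theory Defs
  imports "HOL-Analysis.Analysis" "Jordan_Normal_Form.Schur_Decomposition"
begin

hide_const (open) Determinant.det Matrix.mat
no_notation Matrix.vec_index (infixl "$" 100)


section \<open>The ring of circulants\<close>

text \<open>
  The number \<open>k\<close> of parameters is \<open>CARD('k)\<close>; parameters are indexed from \<open>0\<close> to \<open>k - 1\<close>.
\<close>

typedef 'k circulant = "{f :: nat \<Rightarrow> complex. \<forall>i\<ge>CARD('k::finite). f i = 0}"
  morphisms param Abs_circulant
  by (rule exI[of _ "\<lambda>_. 0"]) simp

definition circulant_of :: "(nat \<Rightarrow> complex) \<Rightarrow> 'k::finite circulant" where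
  "circulant_of f = Abs_circulant (\<lambda>i. if i < CARD('k) then f i else 0)"

lemma param_circulant_of [simp]:
  "param (circulant_of f :: 'k::finite circulant) i = (if i < CARD('k) then f i else 0)"
  unfolding circulant_of_def by (subst Abs_circulant_inverse) auto

lemma param_beyond: "i \<ge> CARD('k) \<Longrightarrow> param (a :: 'k::finite circulant) i = 0"
  using param[of a] by simp

lemma circulant_eqI:
  assumes "\<And>i. i < CARD('k) \<Longrightarrow> param a i = param b i"
  shows "a = (b :: 'k::finite circulant)"
proof -
  have "param a i = param b i" for i
    using assms[of i] param_beyond[of i a] param_beyond[of i b] by (cases "i < CARD('k)") auto
  then show ?thesis by (simp add: param_inject[symmetric] fun_eq_iff)
qed

definition circ :: "'k::finite circulant \<Rightarrow> complex mat" where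
  "circ a = Matrix.mat CARD('k) CARD('k) (\<lambda>(r, c). param a ((r + CARD('k) - c) mod CARD('k)))"

text \<open>
  The product is the cyclic convolution; lemma \<open>circ_times\<close> below shows that it is the product of
  circulant matrices.
\<close>

instantiation circulant :: (finite) "{zero, one, plus, minus, uminus, times}"
begin

definition "0 = circulant_of (\<lambda>_. 0)"
definition "1 = circulant_of (\<lambda>i. if i = 0 then 1 else 0)"
definition "a + b = circulant_of (\<lambda>i. param a i + param b i)"
definition "a - b = circulant_of (\<lambda>i. param a i - param b i)"
definition "- a = circulant_of (\<lambda>i. - param a i)"
definition "a * b = circulant_of
  (\<lambda>i. \<Sum>j<CARD('a). param a ((i + CARD('a) - j) mod CARD('a)) * param b j)"

instance ..

end

lemma mod_sub_iff:
  fixes p q i k :: nat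
  assumes "p < k" "q < k" "i < k"
  shows "(p + q) mod k = i \<longleftrightarrow> p = (i + k - q) mod k"
proof -
  have "(p + q) mod k = (if p + q < k then p + q else p + q - k)"
    using assms by (auto simp: mod_if)
  moreover have "(i + k - q) mod k = (if i < q then i + k - q else i - q)"
    using assms by (auto simp: mod_if)
  ultimately show ?thesis using assms by (auto split: if_splits)
qed

lemma mod_sub_neg:
  fixes r c k :: nat
  assumes r: "r < k" and c: "c < k"
  shows "(k - (r + k - c) mod k) mod k = (c + k - r) mod k"
proof -
  define u where "u = (r + k - c) mod k"
  define p where "p = (k - u) mod k"
  have lt: "u < k" "p < k" "0 < k" using r by (simp_all add: u_def p_def)
  have "(p + r) mod k = (p + (u + c) mod k) mod k"
    using mod_sub_iff[OF lt(1) c r] by (simp add: u_def)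
  also have "\<dots> = ((p + u) mod k + c) mod k" by (simp add: mod_simps ac_simps)
  also have "(p + u) mod k = 0" using mod_sub_iff[OF lt(2,1,3)] by (simp add: p_def)
  finally have "(p + r) mod k = c" using c by simp
  then show ?thesis using mod_sub_iff[OF lt(2) r c] by (simp add: p_def u_def)
qed

lemma mod_sub_sub:
  fixes r c s k :: nat
  assumes r: "r < k" and c: "c < k" and s: "s < k"
  shows "((r + k - c) mod k + k - (s + k - c) mod k) mod k = (r + k - s) mod k"
proof -
  define i where "i = (r + k - c) mod k"
  define u where "u = (s + k - c) mod k"
  define p where "p = (i + k - u) mod k"
  have lt: "i < k" "u < k" "p < k" using r by (simp_all add: i_def u_def p_def)
  have "(p + s) mod k = (p + (u + c) mod k) mod k"
    using mod_sub_iff[OF lt(2) c s] by (simp add: u_def)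
  also have "\<dots> = ((p + u) mod k + c) mod k" by (simp add: mod_simps ac_simps)
  also have "(p + u) mod k = i" using mod_sub_iff[OF lt(3,2,1)] by (simp add: p_def)
  also have "(i + c) mod k = r" using mod_sub_iff[OF lt(1) c r] by (simp add: i_def)
  finally show ?thesis using mod_sub_iff[OF lt(3) s r] by (simp add: p_def u_def i_def)
qed

lemma param_times:
  fixes a b :: "'k::finite circulant"
  assumes i: "i < CARD('k)"
  shows "param (a * b) i =
    (\<Sum>q<CARD('k). \<Sum>p<CARD('k). if (p + q) mod CARD('k) = i then param a p * param b q else 0)"
proof -
  have "(\<Sum>p<CARD('k). if (p + q) mod CARD('k) = i then param a p * param b q else 0)
      = param a ((i + CARD('k) - q) mod CARD('k)) * param b q" if q: "q < CARD('k)" for q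
  proof -
    have "(\<Sum>p<CARD('k). if (p + q) mod CARD('k) = i then param a p * param b q else 0)
        = (\<Sum>p<CARD('k). if p = (i + CARD('k) - q) mod CARD('k) then param a p * param b q else 0)"
      by (rule sum.cong[OF refl]) (use mod_sub_iff[OF _ q i] in auto)
    then show ?thesis by (simp add: sum.delta)
  qed
  then show ?thesis using i by (simp add: times_circulant_def)
qed

lemma sum_collapse_mod:
  fixes f :: "nat \<Rightarrow> 'a::comm_monoid_add"
  shows "m < k \<Longrightarrow> (\<Sum>s<k. if m = s then f s else 0) = f m"
  by (simp add: sum.delta)

lemma times_circulant_comm: "a * b = b * (a :: 'k::finite circulant)"
proof (rule circulant_eqI)
  fix i assume i: "i < CARD('k)"
  show "param (a * b) i = param (b * a) i"
    unfolding param_times[OF i]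
    by (subst sum.swap, intro sum.cong refl) (simp add: add.commute mult.commute)
qed

lemma times_weighted:
  fixes a b :: "'k::finite circulant" and g :: "nat \<Rightarrow> complex"
  shows "(\<Sum>i<CARD('k). param (a * b) i * g i)
    = (\<Sum>q<CARD('k). \<Sum>p<CARD('k). param a p * param b q * g ((p + q) mod CARD('k)))"
proof -
  let ?k = "CARD('k)"
  have "(\<Sum>i<?k. param (a * b) i * g i)
      = (\<Sum>i<?k. \<Sum>q<?k. \<Sum>p<?k. if (p + q) mod ?k = i then param a p * param b q * g i else 0)"
    by (intro sum.cong refl)
      (simp add: param_times sum_distrib_right if_distrib[of "\<lambda>x. x * _"] cong: if_cong)
  also have "\<dots> = (\<Sum>q<?k. \<Sum>p<?k. \<Sum>i<?k. if (p + q) mod ?k = i then param a p * param b q * g i else 0)"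
    by (rule trans[OF sum.swap], rule sum.cong[OF refl], rule sum.swap)
  also have "\<dots> = (\<Sum>q<?k. \<Sum>p<?k. param a p * param b q * g ((p + q) mod ?k))"
    by (intro sum.cong refl, rule sum_collapse_mod) simp
  finally show ?thesis .
qed

lemma times_circulant_assoc: "(a * b) * c = a * (b * (c :: 'k::finite circulant))"
proof (rule circulant_eqI)
  let ?k = "CARD('k)"
  fix i assume i: "i < ?k"
  have L: "param (a * b * c) i = (\<Sum>r<?k. \<Sum>q<?k. \<Sum>p<?k.
      param a p * param b q * (if (p + q + r) mod ?k = i then param c r else 0))"
  proof -
    have "param (a * b * c) i =
        (\<Sum>r<?k. \<Sum>s<?k. param (a * b) s * (if (s + r) mod ?k = i then param c r else 0))"
      by (simp add: param_times[OF i] if_distrib[of "\<lambda>x. _ * x"] cong: if_cong)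
    then show ?thesis by (simp add: times_weighted mod_add_left_eq)
  qed
  have R: "param (b * c * a) i = (\<Sum>p<?k. \<Sum>r<?k. \<Sum>q<?k.
      param b q * param c r * (if (q + r + p) mod ?k = i then param a p else 0))"
  proof -
    have "param (b * c * a) i =
        (\<Sum>r<?k. \<Sum>s<?k. param (b * c) s * (if (s + r) mod ?k = i then param a r else 0))"
      by (simp add: param_times[OF i] if_distrib[of "\<lambda>x. _ * x"] cong: if_cong)
    then show ?thesis by (simp add: times_weighted mod_add_left_eq)
  qed
  have "param (b * c * a) i = (\<Sum>r<?k. \<Sum>q<?k. \<Sum>p<?k.
      param b q * param c r * (if (q + r + p) mod ?k = i then param a p else 0))"
    unfolding R by (rule trans[OF sum.swap], rule sum.cong[OF refl], rule sum.swap)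
  also have "\<dots> = param (a * b * c) i"
    unfolding L by (intro sum.cong refl) (simp add: ac_simps)
  finally show "param (a * b * c) i = param (a * (b * c)) i"
    by (simp add: times_circulant_comm)
qed

lemma param_zero [simp]: "param (0 :: 'k::finite circulant) i = 0"
  by (simp add: zero_circulant_def)

lemma param_one: "param (1 :: 'k::finite circulant) i = (if i = 0 then 1 else 0)"
  by (simp add: one_circulant_def)

lemma param_add [simp]: "param (a + b :: 'k::finite circulant) i = param a i + param b i"
  using param_beyond[of i a] param_beyond[of i b] by (simp add: plus_circulant_def)

lemma param_minus [simp]: "param (a - b :: 'k::finite circulant) i = param a i - param b i"
  using param_beyond[of i a] param_beyond[of i b] by (simp add: minus_circulant_def)

lemma param_uminus [simp]: "param (- a :: 'k::finite circulant) i = - param a i"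
  using param_beyond[of i a] by (simp add: uminus_circulant_def)

instance circulant :: (finite) comm_ring_1
proof
  fix a b c :: "'a circulant"
  show "a * b * c = a * (b * c)" by (rule times_circulant_assoc)
  show "a * b = b * a" by (rule times_circulant_comm)
  show "1 * a = a"
  proof (rule circulant_eqI)
    fix i assume i: "i < CARD('a)"
    have "param (a * 1) i = param a ((i + CARD('a) - 0) mod CARD('a))"
      using i by (simp add: times_circulant_def param_one if_distrib[of "\<lambda>x. _ * x"] sum.delta cong: if_cong)
    then show "param (1 * a) i = param a i" using i by (simp add: times_circulant_comm)
  qed
  show "(a + b) * c = a * c + b * c"
    by (rule circulant_eqI) (simp add: times_circulant_def sum.distrib distrib_right)
  show "(0 :: 'a circulant) \<noteq> 1"
  proof
    assume "(0 :: 'a circulant) = 1"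
    then have "param (0 :: 'a circulant) 0 = param (1 :: 'a circulant) 0" by simp
    then show False by (simp add: param_one)
  qed
qed (auto intro!: circulant_eqI simp: algebra_simps)

lemma param_sum: "param (sum f S :: 'k::finite circulant) i = (\<Sum>s\<in>S. param (f s) i)"
  by (induction S rule: infinite_finite_induct) auto

lemma circ_carrier [simp]: "circ (a :: 'k::finite circulant) \<in> carrier_mat CARD('k) CARD('k)"
  by (simp add: circ_def)

lemma circ_dim [simp]:
  "dim_row (circ (a :: 'k::finite circulant)) = CARD('k)"
  "dim_col (circ (a :: 'k::finite circulant)) = CARD('k)"
  by (simp_all add: circ_def)

lemma circ_index:
  "r < CARD('k) \<Longrightarrow> c < CARD('k) \<Longrightarrow>
    circ (a :: 'k::finite circulant) $$ (r, c) = param a ((r + CARD('k) - c) mod CARD('k))"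
  by (simp add: circ_def)

lemma circ_inj: "circ a = circ b \<Longrightarrow> a = (b :: 'k::finite circulant)"
proof (rule circulant_eqI)
  fix i assume eq: "circ a = circ b" and i: "i < CARD('k)"
  have "circ a $$ (i, 0) = circ b $$ (i, 0)" using eq by simp
  then show "param a i = param b i" using i by (simp add: circ_index)
qed

lemma circ_times: "circ (a * b) = circ a * circ (b :: 'k::finite circulant)"
proof (rule eq_matI)
  let ?k = "CARD('k)"
  fix r c assume "r < dim_row (circ a * circ b)" "c < dim_col (circ a * circ b)"
  then have r: "r < ?k" and c: "c < ?k" by simp_all
  let ?i = "(r + ?k - c) mod ?k"
  have i: "?i < ?k" by simp
  have "(circ a * circ b) $$ (r, c)
      = (\<Sum>s<?k. param a ((r + ?k - s) mod ?k) * param b ((s + ?k - c) mod ?k))"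
    using r c by (simp add: scalar_prod_def circ_index atLeast0LessThan)
  also have "\<dots> = (\<Sum>j<?k. param a ((?i + ?k - j) mod ?k) * param b j)"
  proof (rule sum.reindex_bij_witness[of _ "\<lambda>j. (j + c) mod ?k" "\<lambda>s. (s + ?k - c) mod ?k"])
    fix s assume "s \<in> {..<?k}"
    then have s: "s < ?k" by simp
    show "(s + ?k - c) mod ?k \<in> {..<?k}" by simp
    show "((s + ?k - c) mod ?k + c) mod ?k = s"
      by (rule iffD2[OF mod_sub_iff[OF _ c s]]) simp_all
    show "param a ((?i + ?k - (s + ?k - c) mod ?k) mod ?k) * param b ((s + ?k - c) mod ?k)
        = param a ((r + ?k - s) mod ?k) * param b ((s + ?k - c) mod ?k)"
      by (simp only: mod_sub_sub[OF r c s])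
  next
    fix j assume "j \<in> {..<?k}"
    then have j: "j < ?k" by simp
    show "(j + c) mod ?k \<in> {..<?k}" by simp
    show "((j + c) mod ?k + ?k - c) mod ?k = j"
      by (rule iffD1[OF mod_sub_iff[OF j c], symmetric]) simp_all
  qed
  also have "\<dots> = circ (a * b) $$ (r, c)" using r c by (simp add: circ_index times_circulant_def)
  finally show "circ (a * b) $$ (r, c) = (circ a * circ b) $$ (r, c)" by simp
qed simp_all


lemma circ_one: "circ (1 :: 'k::finite circulant) = 1\<^sub>m CARD('k)"
proof (rule eq_matI)
  fix r c assume "r < dim_row (1\<^sub>m CARD('k) :: complex mat)" "c < dim_col (1\<^sub>m CARD('k) :: complex mat)"
  then have r: "r < CARD('k)" and c: "c < CARD('k)" by simp_all
  have "(r + CARD('k) - c) mod CARD('k) = 0 \<longleftrightarrow> r = c"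
    using mod_sub_iff[of 0 "CARD('k)" c r] r c by auto
  then show "circ (1 :: 'k circulant) $$ (r, c) = (1\<^sub>m CARD('k) :: complex mat) $$ (r, c)"
    using r c by (simp add: circ_index param_one)
qed simp_all

lemma circ_add: "circ (a + b) = circ a + circ (b :: 'k::finite circulant)"
  by (rule eq_matI) (auto simp: circ_index)


section \<open>Fourier coefficients\<close>

definition root_of_unity :: "nat \<Rightarrow> complex" where
  "root_of_unity k = exp (2 * of_real pi * \<i> / of_nat k)"

definition fourier_mat :: "nat \<Rightarrow> complex mat" where
  "fourier_mat k = Matrix.mat k k (\<lambda>(i, j). root_of_unity k ^ (i * j) / of_real (sqrt (real k)))"

definition cft :: "'k::finite circulant \<Rightarrow> complex mat" where
  "cft a = mat_adjoint (fourier_mat CARD('k)) * circ a * fourier_mat CARD('k)"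

text \<open>The \<open>j\<close>-th Fourier coefficient, for \<open>j < k\<close>, of an element, a vector and a matrix.\<close>

definition hat :: "'k::finite circulant \<Rightarrow> nat \<Rightarrow> complex" where
  "hat a j = cft a $$ (j, j)"

definition hat_vec :: "('k::finite circulant)^'n \<Rightarrow> nat \<Rightarrow> complex^'n" where
  "hat_vec x j = (\<chi> i. hat (x $ i) j)"

definition hat_mat :: "('k::finite circulant)^'n^'m \<Rightarrow> nat \<Rightarrow> complex^'n^'m" where
  "hat_mat A j = (\<chi> r s. hat (A $ r $ s) j)"

lemma mat_adjoint_dim [simp]:
  "dim_row (mat_adjoint M) = dim_col M" "dim_col (mat_adjoint M) = dim_row M"
  by (simp_all add: mat_adjoint_def)

lemma mat_adjoint_index:
  "i < dim_col M \<Longrightarrow> j < dim_row M \<Longrightarrow> mat_adjoint M $$ (i, j) = cnj (M $$ (j, i))"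
  by (simp add: mat_adjoint_def mat_of_rows_def)

lemma root_of_unity_pow_k: "k > 0 \<Longrightarrow> root_of_unity k ^ k = 1"
  by (simp add: root_of_unity_def exp_of_nat_mult[symmetric] exp_eq_1)

lemma root_of_unity_cnj: "cnj (root_of_unity k) * root_of_unity k = 1"
proof -
  have "root_of_unity k = cis (2 * pi / of_nat k)"
    by (simp add: root_of_unity_def cis_conv_exp mult_ac)
  then show ?thesis by (simp add: cis_cnj cis_mult)
qed

lemma root_of_unity_pow_mod: "k > 0 \<Longrightarrow> root_of_unity k ^ (n mod k) = root_of_unity k ^ n"
proof -
  assume k: "k > 0"
  have "root_of_unity k ^ n = root_of_unity k ^ (n mod k + k * (n div k))" by simp
  also have "\<dots> = root_of_unity k ^ (n mod k) * (root_of_unity k ^ k) ^ (n div k)"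
    by (simp only: power_add power_mult)
  finally show ?thesis by (simp add: root_of_unity_pow_k[OF k])
qed

lemma root_of_unity_pow_inj:
  assumes "i < k" "j < k" "root_of_unity k ^ i = root_of_unity k ^ j"
  shows "i = j"
proof -
  have "root_of_unity k ^ l = cis (2 * pi * real l / real k)" for l
  proof -
    have "root_of_unity k = cis (2 * pi / of_nat k)"
      by (simp add: root_of_unity_def cis_conv_exp mult_ac)
    then have "root_of_unity k ^ l = cis (real l * (2 * pi / of_nat k))"
      by (simp only: Complex.DeMoivre)
    then show ?thesis by (simp add: mult_ac)
  qed
  then have "cis (2 * pi * real i / real k) = cis (2 * pi * real j / real k)" using assms(3) by simp
  moreover have "inj_on (\<lambda>l. cis (2 * pi * real l / real k)) {..<k}"
    using Complex.bij_betw_roots_unity[of k] assms(1) by (auto simp: bij_betw_def)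
  ultimately show ?thesis using assms(1,2) by (auto dest: inj_onD)
qed

lemma root_of_unity_orth:
  assumes "i < k" "j < k"
  shows "(\<Sum>r<k. cnj (root_of_unity k ^ (r * i)) * root_of_unity k ^ (r * j))
    = (if i = j then of_nat k else 0)"
proof -
  let ?w = "root_of_unity k"
  define z where "z = cnj ?w ^ i * ?w ^ j"
  have e: "cnj (?w ^ (r * i)) * ?w ^ (r * j) = z ^ r" for r
    by (simp add: z_def power_mult_distrib power_mult[symmetric] mult.commute)
  have one: "cnj ?w ^ n * ?w ^ n = 1" for n
    by (simp add: power_mult_distrib[symmetric] root_of_unity_cnj)
  show ?thesis
  proof (cases "i = j")
    case True
    then show ?thesis unfolding e by (simp add: z_def one)
  next
    case False
    have "z \<noteq> 1"
    proof
      assume "z = 1"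
      then have "?w ^ i * z = ?w ^ i" by simp
      moreover have "?w ^ i * z = ?w ^ j" using one[of i] by (simp add: z_def mult_ac)
      ultimately show False using root_of_unity_pow_inj[OF assms] False by simp
    qed
    moreover have "z ^ k = 1"
    proof -
      have "z ^ k = cnj ((?w ^ k) ^ i) * (?w ^ k) ^ j"
        by (simp add: z_def power_mult_distrib power_mult[symmetric] mult.commute)
      then show ?thesis using assms by (simp add: root_of_unity_pow_k)
    qed
    ultimately show ?thesis unfolding e using False by (simp add: geometric_sum)
  qed
qed

lemma circ_fourier:
  fixes a :: "'k::finite circulant"
  assumes r: "r < CARD('k)"
  shows "(\<Sum>c<CARD('k). param a ((r + CARD('k) - c) mod CARD('k)) * root_of_unity CARD('k) ^ (c * j))
    = (\<Sum>l<CARD('k). param a l * cnj (root_of_unity CARD('k)) ^ (j * l)) * root_of_unity CARD('k) ^ (r * j)"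
proof -
  let ?k = "CARD('k)" and ?w = "root_of_unity CARD('k)"
  have "(\<Sum>c<?k. param a ((r + ?k - c) mod ?k) * ?w ^ (c * j))
      = (\<Sum>l<?k. param a l * cnj ?w ^ (j * l) * ?w ^ (r * j))"
  proof (rule sum.reindex_bij_witness[of _ "\<lambda>l. (r + ?k - l) mod ?k" "\<lambda>c. (r + ?k - c) mod ?k"])
    fix c assume "c \<in> {..<?k}"
    then have c: "c < ?k" by simp
    define l where "l = (r + ?k - c) mod ?k"
    have l: "l < ?k" by (simp add: l_def)
    have lc: "(l + c) mod ?k = r" using mod_sub_iff[OF l c r] by (simp add: l_def)
    then show "(r + ?k - (r + ?k - c) mod ?k) mod ?k = c"
      using mod_sub_iff[OF c l r] by (simp add: l_def add.commute)
    show "(r + ?k - c) mod ?k \<in> {..<?k}" by simp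
    have "?w ^ (r * j) = (?w ^ r) ^ j" by (simp add: power_mult)
    also have "?w ^ r = ?w ^ (l + c)"
      using root_of_unity_pow_mod[of ?k "l + c"] lc by simp
    finally have "cnj ?w ^ (j * l) * ?w ^ (r * j) = (cnj ?w * ?w) ^ (j * l) * ?w ^ (c * j)"
      by (simp add: power_mult_distrib power_add power_mult[symmetric] mult.commute)
    then have "cnj ?w ^ (j * l) * ?w ^ (r * j) = ?w ^ (c * j)" by (simp add: root_of_unity_cnj)
    then show "param a ((r + ?k - c) mod ?k) * cnj ?w ^ (j * ((r + ?k - c) mod ?k)) * ?w ^ (r * j)
        = param a ((r + ?k - c) mod ?k) * ?w ^ (c * j)"
      by (simp add: l_def[symmetric] mult.assoc)
  next
    fix l assume "l \<in> {..<?k}"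
    then have l: "l < ?k" by simp
    define c where "c = (r + ?k - l) mod ?k"
    have c: "c < ?k" by (simp add: c_def)
    have lc: "(c + l) mod ?k = r" using mod_sub_iff[OF c l r] by (simp add: c_def)
    then show "(r + ?k - (r + ?k - l) mod ?k) mod ?k = l"
      using mod_sub_iff[OF l c r] by (simp add: c_def add.commute)
    show "(r + ?k - l) mod ?k \<in> {..<?k}" by simp
  qed
  then show ?thesis by (simp add: sum_distrib_right)
qed

lemma cft_assoc:
  fixes a :: "'k::finite circulant"
  shows "cft a = mat_adjoint (fourier_mat CARD('k)) * (circ a * fourier_mat CARD('k))"
proof -
  have "fourier_mat CARD('k) \<in> carrier_mat CARD('k) CARD('k)" by (simp add: fourier_mat_def)
  moreover from this have "mat_adjoint (fourier_mat CARD('k)) \<in> carrier_mat CARD('k) CARD('k)"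
    by (intro carrier_matI) (simp_all del: One_nat_def)
  ultimately show ?thesis unfolding cft_def by (metis assoc_mult_mat circ_carrier)
qed

lemma cft_entry:
  fixes a :: "'k::finite circulant"
  assumes i: "i < CARD('k)" and j: "j < CARD('k)"
  shows "cft a $$ (i, j) =
    (if i = j then \<Sum>l<CARD('k). param a l * cnj (root_of_unity CARD('k)) ^ (j * l) else 0)"
proof -
  let ?k = "CARD('k)" and ?w = "root_of_unity CARD('k)"
  let ?h = "\<Sum>l<?k. param a l * cnj ?w ^ (j * l)"
  have sq: "complex_of_real (sqrt (real ?k)) * of_real (sqrt (real ?k)) = of_nat ?k"
    by (simp flip: of_real_mult)
  note m = cft_assoc[of a]
  have inner: "(circ a * fourier_mat ?k) $$ (r, j) = ?h * ?w ^ (r * j) / of_real (sqrt (real ?k))"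
    if r: "r < ?k" for r
  proof -
    have "(circ a * fourier_mat ?k) $$ (r, j)
        = (\<Sum>c<?k. param a ((r + ?k - c) mod ?k) * ?w ^ (c * j) / of_real (sqrt (real ?k)))"
      using r j by (simp add: scalar_prod_def circ_index fourier_mat_def atLeast0LessThan)
    then show ?thesis by (simp add: sum_divide_distrib[symmetric] circ_fourier[OF r])
  qed
  have "cft a $$ (i, j) = (\<Sum>r<?k. mat_adjoint (fourier_mat ?k) $$ (i, r) * (circ a * fourier_mat ?k) $$ (r, j))"
    unfolding m using i j by (simp add: scalar_prod_def atLeast0LessThan fourier_mat_def)
  also have "\<dots> = (\<Sum>r<?k. ?h / of_nat ?k * (cnj (?w ^ (r * i)) * ?w ^ (r * j)))"
  proof (rule sum.cong[OF refl])
    fix r assume "r \<in> {..<?k}"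
    then have r: "r < ?k" by simp
    have "mat_adjoint (fourier_mat ?k) $$ (i, r) = cnj (?w ^ (r * i)) / of_real (sqrt (real ?k))"
      using r i by (simp add: mat_adjoint_index fourier_mat_def)
    then show "mat_adjoint (fourier_mat ?k) $$ (i, r) * (circ a * fourier_mat ?k) $$ (r, j)
        = ?h / of_nat ?k * (cnj (?w ^ (r * i)) * ?w ^ (r * j))"
      unfolding inner[OF r] by (simp add: sq[symmetric] mult_ac)
  qed
  also have "\<dots> = ?h / of_nat ?k * (if i = j then of_nat ?k else 0)"
    by (simp only: sum_distrib_left[symmetric] root_of_unity_orth[OF i j])
  finally show ?thesis by simp
qed

lemma hat_formula:
  "j < CARD('k) \<Longrightarrow>
    hat (a :: 'k::finite circulant) j = (\<Sum>l<CARD('k). param a l * cnj (root_of_unity CARD('k)) ^ (j * l))"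
  by (simp add: hat_def cft_entry)

lemma cft_eq: "cft (a :: 'k::finite circulant) = mat_diag CARD('k) (hat a)"
  by (rule eq_matI)
    (auto simp: cft_entry hat_formula mat_diag_def, auto simp: cft_def fourier_mat_def)

lemma fourier_inversion:
  fixes a :: "'k::finite circulant"
  assumes l: "l < CARD('k)"
  shows "(\<Sum>j<CARD('k). hat a j * root_of_unity CARD('k) ^ (j * l)) = of_nat CARD('k) * param a l"
proof -
  let ?k = "CARD('k)" and ?w = "root_of_unity CARD('k)"
  have "(\<Sum>j<?k. hat a j * ?w ^ (j * l))
      = (\<Sum>j<?k. \<Sum>m<?k. param a m * (cnj (?w ^ (j * m)) * ?w ^ (j * l)))"
    by (rule sum.cong[OF refl]) (simp add: hat_formula sum_distrib_left mult_ac)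
  also have "\<dots> = (\<Sum>m<?k. param a m * (\<Sum>j<?k. cnj (?w ^ (j * m)) * ?w ^ (j * l)))"
    by (subst sum.swap) (simp add: sum_distrib_left)
  also have "\<dots> = (\<Sum>m<?k. if m = l then of_nat ?k * param a m else 0)"
    by (rule sum.cong[OF refl]) (use l in \<open>auto simp: root_of_unity_orth simp del: complex_cnj_power\<close>)
  finally show ?thesis using l by (simp add: sum.delta)
qed

lemma hat_inj:
  assumes "\<And>j. j < CARD('k) \<Longrightarrow> hat a j = hat b j"
  shows "a = (b :: 'k::finite circulant)"
proof (rule circulant_eqI)
  fix l assume l: "l < CARD('k)"
  have "of_nat CARD('k) * param a l = of_nat CARD('k) * param b l"
    using assms by (simp flip: fourier_inversion[OF l])
  then show "param a l = param b l" by simp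
qed

lemma hat_eq_iff: "a = b \<longleftrightarrow> (\<forall>j<CARD('k). hat a j = hat (b :: 'k::finite circulant) j)"
  using hat_inj[of a b] by auto

lemma hat_surj: "\<exists>a :: 'k::finite circulant. \<forall>j<CARD('k). hat a j = f j"
proof -
  let ?k = "CARD('k)" and ?w = "root_of_unity CARD('k)"
  define a :: "'k circulant" where "a = circulant_of (\<lambda>l. (\<Sum>m<?k. f m * ?w ^ (m * l)) / of_nat ?k)"
  have "hat a j = f j" if j: "j < ?k" for j
  proof -
    have "hat a j = (\<Sum>l<?k. \<Sum>m<?k. f m / of_nat ?k * (cnj (?w ^ (l * j)) * ?w ^ (l * m)))"
      unfolding hat_formula[OF j]
      by (rule sum.cong[OF refl])
        (simp add: a_def sum_divide_distrib sum_distrib_left mult_ac)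
    also have "\<dots> = (\<Sum>m<?k. f m / of_nat ?k * (\<Sum>l<?k. cnj (?w ^ (l * j)) * ?w ^ (l * m)))"
      by (subst sum.swap) (simp add: sum_distrib_left)
    also have "\<dots> = (\<Sum>m<?k. if m = j then f m else 0)"
      by (rule sum.cong[OF refl]) (use j in \<open>auto simp: root_of_unity_orth simp del: complex_cnj_power\<close>)
    finally show ?thesis using j by (simp add: sum.delta)
  qed
  then show ?thesis by blast
qed

lemma hat_unique:
  "\<exists>!a :: 'k::finite circulant. \<forall>j<CARD('k). hat a j = f j"
  using hat_surj[of f] hat_inj by metis

lemma mat_diag_eq_iff: "mat_diag k f = mat_diag k g \<longleftrightarrow> (\<forall>j<k. f j = g j)"
proof
  assume eq: "mat_diag k f = mat_diag k g"
  show "\<forall>j<k. f j = g j"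
  proof (intro allI impI)
    fix j assume "j < k"
    then have "mat_diag k f $$ (j, j) = f j" "mat_diag k g $$ (j, j) = g j"
      by (simp_all add: mat_diag_def)
    then show "f j = g j" using eq by simp
  qed
next
  assume "\<forall>j<k. f j = g j"
  then show "mat_diag k f = mat_diag k g" by (intro eq_matI) (auto simp: mat_diag_def)
qed

lemma hat_the_cft:
  assumes "j < CARD('k)"
  shows "hat (THE b :: 'k::finite circulant. cft b = mat_diag CARD('k) f) j = f j"
proof -
  have "\<exists>!b :: 'k circulant. cft b = mat_diag CARD('k) f"
    unfolding cft_eq mat_diag_eq_iff by (rule hat_unique)
  then have "cft (THE b :: 'k circulant. cft b = mat_diag CARD('k) f) = mat_diag CARD('k) f"
    by (rule theI')
  then show ?thesis using assms unfolding cft_eq mat_diag_eq_iff by blast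
qed

lemma hat_add: "j < CARD('k) \<Longrightarrow> hat (a + b :: 'k::finite circulant) j = hat a j + hat b j"
  by (simp add: hat_formula distrib_right sum.distrib)

lemma hat_minus: "j < CARD('k) \<Longrightarrow> hat (a - b :: 'k::finite circulant) j = hat a j - hat b j"
  by (simp add: hat_formula left_diff_distrib sum_subtractf)

lemma hat_zero: "j < CARD('k) \<Longrightarrow> hat (0 :: 'k::finite circulant) j = 0"
  by (simp add: hat_formula)

lemma hat_one: "j < CARD('k) \<Longrightarrow> hat (1 :: 'k::finite circulant) j = 1"
  by (simp add: hat_formula param_one if_distrib[of "\<lambda>x. x * _"] sum.delta cong: if_cong)

lemma hat_times:
  assumes j: "j < CARD('k)"
  shows "hat (a * b :: 'k::finite circulant) j = hat a j * hat b j"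
proof -
  let ?k = "CARD('k)" and ?w = "cnj (root_of_unity CARD('k))"
  have w: "?w ^ (j * (n mod ?k)) = ?w ^ (j * n)" for n
  proof -
    have "(?w ^ (n mod ?k)) ^ j = (?w ^ n) ^ j"
      using root_of_unity_pow_mod[of ?k n] by (metis complex_cnj_power zero_less_card_finite)
    then show ?thesis by (simp add: power_mult[symmetric] mult.commute)
  qed
  have "hat (a * b) j = (\<Sum>q<?k. \<Sum>p<?k. param a p * param b q * ?w ^ (j * (p + q)))"
    unfolding hat_formula[OF j] times_weighted w ..
  also have "\<dots> = (\<Sum>q<?k. (\<Sum>p<?k. param a p * ?w ^ (j * p)) * (param b q * ?w ^ (j * q)))"
    by (simp add: sum_distrib_left sum_distrib_right distrib_left power_add mult_ac)
  finally show ?thesis by (simp add: hat_formula[OF j] sum_distrib_left)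
qed

lemma hat_sum: "j < CARD('k) \<Longrightarrow> hat (sum f S :: 'k::finite circulant) j = (\<Sum>s\<in>S. hat (f s) j)"
  by (induction S rule: infinite_finite_induct) (auto simp: hat_zero hat_add)


section \<open>Order, absolute value, angle, inverse and norm\<close>

text \<open>The order on \<open>complex\<close> compares real parts and requires equal imaginary parts.\<close>

definition kle :: "'k::finite circulant \<Rightarrow> 'k circulant \<Rightarrow> bool" where
  "kle a b \<longleftrightarrow> (\<forall>j<CARD('k). hat a j \<le> hat b j)"

definition kless :: "'k::finite circulant \<Rightarrow> 'k circulant \<Rightarrow> bool" where
  "kless a b \<longleftrightarrow> (\<forall>j<CARD('k). hat a j < hat b j)"

definition kabs :: "'k::finite circulant \<Rightarrow> 'k circulant" where
  "kabs a = (THE b. cft b = mat_diag CARD('k) (\<lambda>j. of_real (cmod (hat a j))))"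

text \<open>The angle is meaningful only if no Fourier coefficient vanishes, i.e. if \<open>a\<close> is a unit.\<close>

definition kangle :: "'k::finite circulant \<Rightarrow> 'k circulant" where
  "kangle a = (THE b. cft b = mat_diag CARD('k) (\<lambda>j. hat a j / of_real (cmod (hat a j))))"

definition kinv :: "'k::finite circulant \<Rightarrow> 'k circulant" where
  "kinv a = (THE b. a * b = 1)"

definition pos_semidefinite :: "complex mat \<Rightarrow> bool" where
  "pos_semidefinite M \<longleftrightarrow> mat_adjoint M = M \<and>
    (\<forall>v\<in>carrier_vec (dim_row M). 0 \<le> (M *\<^sub>v v) \<bullet>c v)"

text \<open>
  The norm is the element whose circulant matrix is the positive semidefinite square root of
  the sum of the matrices \<open>circ(x_i)^* circ(x_i)\<close>; see lemma \<open>hat_knorm\<close> for its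
  Fourier coefficients.
\<close>

definition knorm :: "('k::finite circulant)^'n \<Rightarrow> 'k circulant" where
  "knorm x = (THE b. pos_semidefinite (circ b) \<and>
    circ b * circ b = Matrix.mat CARD('k) CARD('k)
      (\<lambda>(r, c). \<Sum>i\<in>UNIV. (mat_adjoint (circ (x $ i)) * circ (x $ i)) $$ (r, c)))"

lemma hat_kabs: "j < CARD('k) \<Longrightarrow> hat (kabs (a :: 'k::finite circulant)) j = of_real (cmod (hat a j))"
  unfolding kabs_def by (rule hat_the_cft)

lemma hat_kangle:
  "j < CARD('k) \<Longrightarrow> hat (kangle (a :: 'k::finite circulant)) j = hat a j / of_real (cmod (hat a j))"
  unfolding kangle_def by (rule hat_the_cft)

lemma unit_iff: "(a :: 'k::finite circulant) dvd 1 \<longleftrightarrow> (\<forall>j<CARD('k). hat a j \<noteq> 0)"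
proof
  assume "a dvd 1"
  then obtain b where "1 = a * b" by (rule dvdE)
  then have "hat a j * hat b j = 1" if "j < CARD('k)" for j
    using that hat_times[of j a b] hat_one[of j, where 'k = 'k] by simp
  then show "\<forall>j<CARD('k). hat a j \<noteq> 0" by force
next
  assume nz: "\<forall>j<CARD('k). hat a j \<noteq> 0"
  obtain b :: "'k circulant" where b: "\<forall>j<CARD('k). hat b j = inverse (hat a j)"
    using hat_surj[of "\<lambda>j. inverse (hat a j)"] by (elim exE)
  have "a * b = 1" by (rule hat_inj) (use nz b in \<open>simp add: hat_times hat_one\<close>)
  then show "a dvd 1" by (metis dvdI)
qed

lemma times_kinv: "(a :: 'k::finite circulant) dvd 1 \<Longrightarrow> a * kinv a = 1"
proof -
  assume "a dvd 1"
  then obtain b where b: "1 = a * b" by (rule dvdE)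
  have "\<exists>!b. a * b = 1"
  proof (rule ex1I)
    show "a * b = 1" using b by simp
    fix c assume "a * c = 1"
    then have "b * (a * c) = b" by simp
    then show "c = b" using b by (metis mult.commute mult.left_commute mult.right_neutral)
  qed
  then show ?thesis unfolding kinv_def by (rule theI')
qed

lemma hat_kinv:
  assumes "(a :: 'k::finite circulant) dvd 1" "j < CARD('k)"
  shows "hat (kinv a) j = inverse (hat a j)"
proof -
  have "hat a j * hat (kinv a) j = 1"
    using times_kinv[OF assms(1)] hat_times[OF assms(2), of a "kinv a"] hat_one[OF assms(2)] by simp
  then show ?thesis by (metis inverse_unique)
qed

definition star :: "'k::finite circulant \<Rightarrow> 'k circulant" where
  "star a = circulant_of (\<lambda>l. cnj (param a ((CARD('k) - l) mod CARD('k))))"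

lemma circ_star: "circ (star a) = mat_adjoint (circ (a :: 'k::finite circulant))"
proof (rule eq_matI)
  let ?k = "CARD('k)"
  fix r c assume "r < dim_row (mat_adjoint (circ a))" "c < dim_col (mat_adjoint (circ a))"
  then have r: "r < ?k" and c: "c < ?k" by simp_all
  have "(?k - (r + ?k - c) mod ?k) mod ?k = (c + ?k - r) mod ?k" by (rule mod_sub_neg[OF r c])
  then show "circ (star a) $$ (r, c) = mat_adjoint (circ a) $$ (r, c)"
    using r c by (simp add: circ_index mat_adjoint_index star_def)
qed simp_all

lemma hat_star:
  assumes j: "j < CARD('k)"
  shows "hat (star a :: 'k::finite circulant) j = cnj (hat a j)"
proof -
  let ?k = "CARD('k)" and ?w = "root_of_unity CARD('k)"
  have "hat (star a) j = (\<Sum>l<?k. cnj (param a ((?k - l) mod ?k)) * cnj ?w ^ (j * l))"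
    by (simp add: hat_formula[OF j] star_def)
  also have "\<dots> = (\<Sum>m<?k. cnj (param a m) * ?w ^ (j * m))"
  proof (rule sum.reindex_bij_witness[of _ "\<lambda>m. (?k - m) mod ?k" "\<lambda>l. (?k - l) mod ?k"])
    fix l assume "l \<in> {..<?k}"
    then have l: "l < ?k" by simp
    show "(?k - (?k - l) mod ?k) mod ?k = l" using l by (cases "l = 0") auto
    show "(?k - l) mod ?k \<in> {..<?k}" by simp
    define m where "m = (?k - l) mod ?k"
    have "?w ^ (m + l) = ?w ^ ((m + l) mod ?k)" by (simp add: root_of_unity_pow_mod)
    also have "(m + l) mod ?k = 0" using l by (cases "l = 0") (auto simp: m_def)
    finally have "?w ^ (j * m) * ?w ^ (j * l) = 1"
      by (metis distrib_left mult.commute power_0 power_add power_mult power_one)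
    then have "cnj ?w ^ (j * l) = ?w ^ (j * m) * (?w ^ (j * l) * cnj ?w ^ (j * l))"
      by (simp add: mult.assoc[symmetric])
    also have "?w ^ (j * l) * cnj ?w ^ (j * l) = 1"
      by (metis mult.commute power_mult_distrib power_one root_of_unity_cnj)
    finally show "cnj (param a ((?k - l) mod ?k)) * ?w ^ (j * ((?k - l) mod ?k))
        = cnj (param a ((?k - l) mod ?k)) * cnj ?w ^ (j * l)" by (simp add: m_def)
  next
    fix m assume "m \<in> {..<?k}"
    then have m: "m < ?k" by simp
    show "(?k - (?k - m) mod ?k) mod ?k = m" using m by (cases "m = 0") auto
    show "(?k - m) mod ?k \<in> {..<?k}" by simp
  qed
  finally show ?thesis by (simp add: hat_formula[OF j])
qed

lemma scalar_prod_adjoint: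
  fixes M :: "complex mat"
  assumes M: "M \<in> carrier_mat n n" and u: "u \<in> carrier_vec n" and v: "v \<in> carrier_vec n"
  shows "(mat_adjoint M *\<^sub>v u) \<bullet>c v = u \<bullet>c (M *\<^sub>v v)"
proof -
  have "(mat_adjoint M *\<^sub>v u) \<bullet>c v
      = (\<Sum>i<n. \<Sum>l<n. cnj (M $$ (l, i)) * vec_index u l * cnj (vec_index v i))"
    using assms by (simp add: scalar_prod_def mat_adjoint_index atLeast0LessThan sum_distrib_right)
  also have "\<dots> = (\<Sum>l<n. \<Sum>i<n. cnj (M $$ (l, i)) * vec_index u l * cnj (vec_index v i))"
    by (rule sum.swap)
  also have "\<dots> = u \<bullet>c (M *\<^sub>v v)"
    using assms by (simp add: scalar_prod_def atLeast0LessThan sum_distrib_left mult_ac)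
  finally show ?thesis .
qed

lemma pos_semidefinite_circ_iff:
  fixes b :: "'k::finite circulant"
  shows "pos_semidefinite (circ b) \<longleftrightarrow> (\<forall>j<CARD('k). 0 \<le> hat b j)"
proof
  let ?k = "CARD('k)" and ?F = "fourier_mat CARD('k)"
  assume psd: "pos_semidefinite (circ b)"
  have F: "?F \<in> carrier_mat ?k ?k" by (simp add: fourier_mat_def)
  show "\<forall>j<?k. 0 \<le> hat b j"
  proof (intro allI impI)
    fix j assume j: "j < ?k"
    let ?v = "col ?F j"
    have v: "?v \<in> carrier_vec ?k" using F j by (intro carrier_vecI) simp
    note m = cft_assoc[of b]
    have "hat b j = (\<Sum>r<?k. cnj (?F $$ (r, j)) * (circ b * ?F) $$ (r, j))"
    proof -
      define N where "N = circ b * ?F"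
      have "N \<in> carrier_mat ?k ?k" using F by (simp add: N_def mult_carrier_mat[OF circ_carrier])
      then show ?thesis unfolding hat_def m N_def[symmetric] using j F
        by (simp add: scalar_prod_def atLeast0LessThan mat_adjoint_index)
    qed
    also have "\<dots> = (circ b *\<^sub>v ?v) \<bullet>c ?v"
      using j F by (simp add: scalar_prod_def atLeast0LessThan mult.commute)
    finally show "0 \<le> hat b j" using psd v by (simp add: pos_semidefinite_def)
  qed
next
  let ?k = "CARD('k)"
  assume nn: "\<forall>j<?k. 0 \<le> hat b j"
  have re: "hat b j = of_real (Re (hat b j))" "Re (hat b j) \<ge> 0" if "j < ?k" for j
    using nn that by (auto simp: less_eq_complex_def complex_eq_iff)
  obtain m :: "'k circulant" where m: "\<forall>j<?k. hat m j = of_real (sqrt (Re (hat b j)))"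
    using hat_surj[of "\<lambda>j. of_real (sqrt (Re (hat b j)))"] by (elim exE)
  have "star b = b"
    by (rule hat_inj) (metis complex_cnj_complex_of_real hat_star re(1))
  then have herm: "mat_adjoint (circ b) = circ b" by (simp flip: circ_star)
  have "b = star m * m"
  proof (rule hat_inj)
    fix j assume j: "j < ?k"
    have "hat (star m * m) j = of_real (sqrt (Re (hat b j)) * sqrt (Re (hat b j)))"
      unfolding of_real_mult using j m by (simp add: hat_times hat_star del: of_real_sqrt)
    also have "\<dots> = of_real (Re (hat b j))" using re(2)[OF j] by simp
    also have "\<dots> = hat b j" by (rule re(1)[OF j, symmetric])
    finally show "hat b j = hat (star m * m) j" by (rule sym)
  qed
  then have fac: "circ b = mat_adjoint (circ m) * circ m" by (simp add: circ_times circ_star)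
  have "0 \<le> (circ b *\<^sub>v v) \<bullet>c v" if v: "v \<in> carrier_vec ?k" for v
  proof -
    have "circ b *\<^sub>v v = mat_adjoint (circ m) *\<^sub>v (circ m *\<^sub>v v)"
      unfolding fac by (rule assoc_mult_mat_vec[of _ ?k ?k _ ?k]) (use v in \<open>auto intro!: carrier_matI\<close>)
    then have "(circ b *\<^sub>v v) \<bullet>c v = (circ m *\<^sub>v v) \<bullet>c (circ m *\<^sub>v v)"
      using scalar_prod_adjoint[OF circ_carrier _ v, of "circ m *\<^sub>v v" m] v
      by (simp add: mult_mat_vec_carrier[OF circ_carrier])
    then show ?thesis by (simp add: conjugate_square_ge_0_vec)
  qed
  with herm show "pos_semidefinite (circ b)" by (simp add: pos_semidefinite_def)
qed

lemma hat_knorm: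
  fixes x :: "('k::finite circulant)^'n"
  assumes "j < CARD('k)"
  shows "hat (knorm x) j = of_real (norm (hat_vec x j))"
proof -
  let ?k = "CARD('k)"
  have nsq: "(\<Sum>i\<in>UNIV. hat (star (x $ i) * x $ i) j) = of_real (norm (hat_vec x j)) ^ 2"
    if "j < ?k" for j
  proof -
    have "norm (hat_vec x j) ^ 2 = (\<Sum>i\<in>UNIV. cmod (hat (x $ i) j) ^ 2)"
      by (simp add: norm_vec_def L2_set_def hat_vec_def sum_nonneg)
    then have "complex_of_real (norm (hat_vec x j)) ^ 2 = (\<Sum>i\<in>UNIV. of_real (cmod (hat (x $ i) j)) ^ 2)"
      by (metis (no_types, lifting) of_real_power of_real_sum sum.cong)
    moreover have "hat (star (x $ i) * x $ i) j = of_real (cmod (hat (x $ i) j)) ^ 2" for i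
      unfolding hat_times[OF that] hat_star[OF that] of_real_power[symmetric] complex_norm_square by (rule mult.commute)
    ultimately show ?thesis by simp
  qed
  have S: "Matrix.mat ?k ?k (\<lambda>(r, c). \<Sum>i\<in>UNIV. (mat_adjoint (circ (x $ i)) * circ (x $ i)) $$ (r, c))
      = circ (\<Sum>i\<in>UNIV. star (x $ i) * x $ i)"
    unfolding circ_star[symmetric] circ_times[symmetric]
    by (rule eq_matI) (auto simp: circ_index param_sum)
  have eqv: "pos_semidefinite (circ b) \<and> circ b * circ b = Matrix.mat ?k ?k
        (\<lambda>(r, c). \<Sum>i\<in>UNIV. (mat_adjoint (circ (x $ i)) * circ (x $ i)) $$ (r, c))
      \<longleftrightarrow> (\<forall>j<?k. hat b j = of_real (norm (hat_vec x j)))" (is "_ \<longleftrightarrow> ?R") for b :: "'k circulant"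
  proof -
    have "circ b * circ b = circ (\<Sum>i\<in>UNIV. star (x $ i) * x $ i)
        \<longleftrightarrow> b * b = (\<Sum>i\<in>UNIV. star (x $ i) * x $ i)"
      unfolding circ_times[symmetric] by (auto dest: circ_inj)
    also have "\<dots> \<longleftrightarrow> (\<forall>j<?k. hat b j ^ 2 = of_real (norm (hat_vec x j)) ^ 2)"
      unfolding hat_eq_iff
    proof (intro all_cong1 imp_cong refl)
      fix j assume j: "j < ?k"
      show "hat (b * b) j = hat (\<Sum>i\<in>UNIV. star (x $ i) * x $ i) j
          \<longleftrightarrow> hat b j ^ 2 = of_real (norm (hat_vec x j)) ^ 2"
        unfolding hat_times[OF j, of b b] hat_sum[OF j] nsq[OF j] power2_eq_square[of "hat b j"] ..
    qed
    finally have "pos_semidefinite (circ b) \<and> circ b * circ b = circ (\<Sum>i\<in>UNIV. star (x $ i) * x $ i)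
        \<longleftrightarrow> (\<forall>j<?k. 0 \<le> hat b j \<and> hat b j ^ 2 = of_real (norm (hat_vec x j)) ^ 2)"
      by (auto simp: pos_semidefinite_circ_iff)
    moreover have "0 \<le> z \<and> z ^ 2 = of_real r ^ 2 \<longleftrightarrow> z = of_real r" if "r \<ge> 0" for z :: complex and r :: real
      using that by (auto simp: power2_eq_iff less_eq_complex_def complex_eq_iff)
    ultimately show ?thesis unfolding S by simp
  qed
  have "\<exists>!b :: 'k circulant. \<forall>j<?k. hat b j = of_real (norm (hat_vec x j))" by (rule hat_unique)
  from theI'[OF this] show ?thesis using assms unfolding knorm_def eqv by blast
qed


section \<open>Eigenpairs and canonical sets\<close>

definition keigenvalue :: "('k::finite circulant)^'n^'n \<Rightarrow> 'k circulant \<Rightarrow> bool" where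
  "keigenvalue A l \<longleftrightarrow> det (A - mat l) = 0"

definition keigenvector :: "('k::finite circulant)^'n^'n \<Rightarrow> 'k circulant \<Rightarrow> ('k circulant)^'n \<Rightarrow> bool" where
  "keigenvector A l x \<longleftrightarrow> keigenvalue A l \<and> A *v x = l *s x \<and> (\<forall>j<CARD('k). hat_vec x j \<noteq> 0)"

text \<open>
  The pairs \<open>(lam i, ev i)\<close>, \<open>1 \<le> i \<le> m\<close>, reproduce all eigenvalues and
  eigenvectors of \<open>A\<close>: each Fourier component of an eigenvalue is the corresponding
  component of some member, and each Fourier component of an eigenvector is a linear combination
  of the corresponding components of those members which agree with its eigenvalue there. (Linear
  combinations are needed because eigenvectors are determined only up to scaling, and the
  eigenspaces of a block may have dimension greater than one.)
\<close>

definition reproduces ::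
  "('k::finite circulant)^'n^'n \<Rightarrow> nat \<Rightarrow> (nat \<Rightarrow> 'k circulant) \<Rightarrow> (nat \<Rightarrow> ('k circulant)^'n) \<Rightarrow> bool" where
  "reproduces A m lam ev \<longleftrightarrow>
    (\<forall>i\<in>{1..m}. keigenvector A (lam i) (ev i)) \<and>
    (\<forall>l. keigenvalue A l \<longrightarrow> (\<forall>j<CARD('k). \<exists>i\<in>{1..m}. hat l j = hat (lam i) j)) \<and>
    (\<forall>l x. keigenvector A l x \<longrightarrow>
      (\<forall>j<CARD('k). hat_vec x j \<in>
        vec.span {hat_vec (ev i) j | i. i \<in> {1..m} \<and> hat (lam i) j = hat l j}))"

definition canonical_set ::
  "('k::finite circulant)^'n^'n \<Rightarrow> nat \<Rightarrow> (nat \<Rightarrow> 'k circulant) \<Rightarrow> (nat \<Rightarrow> ('k circulant)^'n) \<Rightarrow> bool" where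
  "canonical_set A m lam ev \<longleftrightarrow>
    reproduces A m lam ev \<and>
    (\<forall>m' lam' ev'. reproduces A m' lam' ev' \<longrightarrow> m \<le> m') \<and>
    (\<forall>i\<in>{1..<m}. kle (kabs (lam (i + 1))) (kabs (lam i)))"


section \<open>The power method\<close>

primrec power_iterate ::
  "('k::finite circulant)^'n^'n \<Rightarrow> ('k circulant)^'n \<Rightarrow> nat \<Rightarrow> ('k circulant)^'n" where
  "power_iterate A x0 0 = kinv (knorm x0) *s x0"
| "power_iterate A x0 (Suc t) =
    (let y = A *v power_iterate A x0 t; \<alpha> = knorm y in kinv \<alpha> *s y)"

text \<open>All inverses taken by the power method exist.\<close>

definition no_breakdown :: "('k::finite circulant)^'n^'n \<Rightarrow> ('k circulant)^'n \<Rightarrow> bool" where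
  "no_breakdown A x0 \<longleftrightarrow> knorm x0 dvd 1 \<and> (\<forall>t. knorm (A *v power_iterate A x0 t) dvd 1)"

definition kconst :: "real \<Rightarrow> 'k::finite circulant" where
  "kconst \<tau> = circulant_of (\<lambda>i. if i = 0 then of_real \<tau> else 0)"

definition kconverges :: "(nat \<Rightarrow> ('k::finite circulant)^'n) \<Rightarrow> ('k circulant)^'n \<Rightarrow> bool" where
  "kconverges X x \<longleftrightarrow> (\<forall>\<tau>>0. \<forall>\<^sub>F t in sequentially. kless (knorm (X t - x)) (kconst \<tau>))"

text \<open>
  Circulants are complex here, so orthogonality of \<open>circ \<beta>\<close> is meant with respect to the
  conjugate transpose.
\<close>

definition is_angle :: "'k::finite circulant \<Rightarrow> bool" where
  "is_angle \<beta> \<longleftrightarrow> mat_adjoint (circ \<beta>) * circ \<beta> = 1\<^sub>m CARD('k)"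

definition kconverges_up_to_angle ::
  "(nat \<Rightarrow> ('k::finite circulant)^'n) \<Rightarrow> ('k circulant)^'n \<Rightarrow> bool" where
  "kconverges_up_to_angle X x \<longleftrightarrow>
    (\<exists>\<beta>. (\<forall>t. is_angle (\<beta> t)) \<and> kconverges (\<lambda>t. \<beta> t *s X t) x)"

text \<open>
  Angles are fixed with respect to a reference component \<open>p\<close>, in place of the first one: a
  type \<open>'n\<close> carries no distinguished first index.
\<close>

definition fix_angle :: "'n \<Rightarrow> ('k::finite circulant)^'n \<Rightarrow> ('k circulant)^'n" where
  "fix_angle p x = kinv (kangle (x $ p)) *s x"

definition stopping_criterion ::
  "'n \<Rightarrow> real \<Rightarrow> ('k::finite circulant)^'n^'n \<Rightarrow> ('k circulant)^'n \<Rightarrow> nat \<Rightarrow> bool" where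
  "stopping_criterion p \<tau> A x0 t \<longleftrightarrow>
    kless (knorm (fix_angle p (power_iterate A x0 t) - fix_angle p (power_iterate A x0 (t - 1))))
      (kconst \<tau>)"

text \<open>
  The usual requirement on the starting vector: in each Fourier component it has a nonzero part in
  the (generalized) eigenspace of the dominant eigenvalue, i.e. it does not lie in the sum of the
  generalized eigenspaces of the other eigenvalues.
\<close>

definition generalized_eigenspace :: "complex^'n^'n \<Rightarrow> complex \<Rightarrow> (complex^'n) set" where
  "generalized_eigenspace B \<mu> = {v. \<exists>m. (((*v) (B - mat \<mu>)) ^^ m) v = 0}"

definition nondeficient ::
  "('k::finite circulant)^'n^'n \<Rightarrow> 'k circulant \<Rightarrow> ('k circulant)^'n \<Rightarrow> bool" where
  "nondeficient A l x0 \<longleftrightarrow>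
    (\<forall>j<CARD('k). hat_vec x0 j \<notin>
      vec.span (\<Union>\<mu>\<in>- {hat l j}. generalized_eigenspace (hat_mat A j) \<mu>))"

end

theory Submission
  imports Defs "HOL-Real_Asymp.Real_Asymp" "HOL-Computational_Algebra.Fundamental_Theorem_Algebra"
begin

text \<open>
  In Fourier coordinates the power method runs \<open>k\<close> independent normalized power iterations, one on
  each block \<open>B\<close> of \<open>A\<close>. Since the canonical set contains every block eigenvalue, the
  coefficient \<open>\<mu>\<close> of \<open>\<lambda>\<^sub>1\<close> strictly dominates all other eigenvalues of \<open>B\<close>. Such a block need
  not be diagonalizable: the canonical set has \<open>n\<close> members as soon as one block has \<open>n\<close>
  independent eigenvectors, and in the other blocks even \<open>\<mu>\<close> may be defective. So write the
  starting vector as \<open>v + w\<close> with \<open>v \<noteq> 0\<close> in the generalized eigenspace of \<open>\<mu>\<close> and \<open>w\<close> in the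
  sum of the others. If \<open>s\<close> is maximal with \<open>(B - \<mu>)\<^sup>s v \<noteq> 0\<close>, the
  binomial theorem shows that \<open>B\<^sup>t v\<close> divided by \<open>\<mu>\<^sup>t (t choose s)\<close> tends to the eigenvector
  \<open>\<mu>\<^sup>-\<^sup>s (B - \<mu>)\<^sup>s v\<close>, while \<open>B\<^sup>t w\<close> divided by \<open>\<mu>\<^sup>t\<close> tends to \<open>0\<close>.
  The phase of \<open>\<mu>\<^sup>t\<close> is what the choice of angle removes.
\<close>

hide_const (open) Module.smult


section \<open>Complex vectors and iterated matrices\<close>

lemma norm_smult_vec: "norm (c *s x) = cmod c * norm (x :: complex^'n)"
  by (simp add: norm_vec_def L2_set_def norm_mult power_mult_distrib real_sqrt_mult
      flip: sum_distrib_left)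

lemma tendsto_smult_vec [tendsto_intros]:
  fixes f :: "'a \<Rightarrow> complex"
  assumes "(f \<longlongrightarrow> c) F" "(g \<longlongrightarrow> (x :: complex^'n)) F"
  shows "((\<lambda>t. f t *s g t) \<longlongrightarrow> c *s x) F"
  by (rule vec_tendstoI) (use assms in \<open>auto intro!: tendsto_intros\<close>)

text \<open>As multiplication by a complex scalar, normalization combines with the linearity rules
  for \<open>*s\<close>.\<close>

lemma sgn_vec_smult: "sgn x = of_real (inverse (norm x)) *s (x :: complex^'n)"
  by (simp only: sgn_div_norm Finite_Cartesian_Product.vec_eq_iff vector_scaleR_component
      vector_smult_component) (simp add: scaleR_conv_of_real)

lemma sgn_smult_vec: "sgn (c *s x) = sgn c *s sgn (x :: complex^'n)"
  by (simp add: sgn_vec_smult norm_smult_vec sgn_eq vector_smult_assoc divide_inverse mult_ac)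

lemma mat_mult_vec: "mat a *v x = a *s (x :: 'a::comm_semiring_1^'n)"
  by (simp add: matrix_vector_mult_def Finite_Cartesian_Product.mat_def Finite_Cartesian_Product.vec_eq_iff if_distrib[of "\<lambda>x. x * y" for y]
      cong: if_cong)

lemma diff_mat_mult_vec: "(B - mat a) *v x = B *v x - a *s (x :: 'a::comm_ring_1^'n)"
  by (simp add: matrix_vector_mult_diff_rdistrib mat_mult_vec)

lemma funpow_matrix_add:
  "((*v) (B :: 'a::comm_semiring_1^'n^'n) ^^ t) (x + y) = ((*v) B ^^ t) x + ((*v) B ^^ t) y"
  by (induction t) (simp_all add: matrix_vector_right_distrib)

lemma funpow_matrix_smult:
  "((*v) (B :: 'a::field^'n^'n) ^^ t) (c *s x) = c *s ((*v) B ^^ t) x"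
  by (induction t) (simp_all add: vector_scalar_commute)

lemma funpow_matrix_zero [simp]: "((*v) (B :: 'a::comm_semiring_1^'n^'n) ^^ t) 0 = 0"
  by (induction t) simp_all

lemma funpow_zero_mono:
  fixes B :: "'a::field^'n^'n"
  assumes "((*v) B ^^ m) x = 0" "m \<le> l"
  shows "((*v) B ^^ l) x = 0"
proof -
  have "((*v) B ^^ (l - m + m)) x = ((*v) B ^^ (l - m)) (((*v) B ^^ m) x)"
    by (simp only: funpow_add comp_apply)
  then show ?thesis using assms by simp
qed


section \<open>Generalized eigenvectors span the space\<close>

lemma subspace_generalized_eigenspace: "vec.subspace (generalized_eigenspace B \<mu>)"
proof (rule vec.subspaceI)
  show "0 \<in> generalized_eigenspace B \<mu>"
    by (auto simp: generalized_eigenspace_def intro: exI[of _ 0])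
next
  fix x y assume "x \<in> generalized_eigenspace B \<mu>" "y \<in> generalized_eigenspace B \<mu>"
  then obtain m l where "((*v) (B - mat \<mu>) ^^ m) x = 0" "((*v) (B - mat \<mu>) ^^ l) y = 0"
    by (auto simp: generalized_eigenspace_def)
  then have "((*v) (B - mat \<mu>) ^^ (max m l)) (x + y) = 0"
    using funpow_zero_mono[of m "B - mat \<mu>" x "max m l"] funpow_zero_mono[of l "B - mat \<mu>" y "max m l"]
    by (simp add: funpow_matrix_add)
  then show "x + y \<in> generalized_eigenspace B \<mu>" unfolding generalized_eigenspace_def by blast
next
  fix c x assume "x \<in> generalized_eigenspace B \<mu>"
  then show "c *s x \<in> generalized_eigenspace B \<mu>"
    by (force simp: generalized_eigenspace_def funpow_matrix_smult)
qed

lemma generalized_eigenspace_step: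
  assumes "(B - mat \<mu>) *v x \<in> generalized_eigenspace B \<mu>"
  shows "x \<in> generalized_eigenspace B \<mu>"
proof -
  obtain m where "((*v) (B - mat \<mu>) ^^ m) ((B - mat \<mu>) *v x) = 0"
    using assms by (auto simp: generalized_eigenspace_def)
  then have "((*v) (B - mat \<mu>) ^^ Suc m) x = 0" by (simp add: funpow_swap1)
  then show ?thesis unfolding generalized_eigenspace_def by blast
qed

text \<open>\<open>B - a\<close> is onto on the generalized eigenspace of any \<open>\<nu> \<noteq> a\<close>: solve
  \<open>(B - a) u' = (B - \<nu>) w\<close> by induction and use \<open>B - a = (B - \<nu>) + (\<nu> - a)\<close>.\<close>

lemma generalized_eigenspace_solve:
  fixes B :: "complex^'n^'n"
  assumes ne: "\<nu> \<noteq> a" and "w \<in> generalized_eigenspace B \<nu>"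
  shows "\<exists>u\<in>generalized_eigenspace B \<nu>. (B - mat a) *v u = w"
proof -
  let ?G = "generalized_eigenspace B \<nu>"
  obtain m where "((*v) (B - mat \<nu>) ^^ m) w = 0"
    using assms by (auto simp: generalized_eigenspace_def)
  then show ?thesis
  proof (induction m arbitrary: w)
    case 0
    then show ?case using vec.subspace_0[OF subspace_generalized_eigenspace] by force
  next
    case (Suc m)
    then have "((*v) (B - mat \<nu>) ^^ m) ((B - mat \<nu>) *v w) = 0" by (simp add: funpow_swap1)
    from Suc.IH[OF this] obtain u where u: "u \<in> ?G" "(B - mat a) *v u = (B - mat \<nu>) *v w"
      by blast
    have w: "w \<in> ?G" using Suc.prems unfolding generalized_eigenspace_def by blast
    define z where "z = (1 / (\<nu> - a)) *s (w - u)"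
    have "z \<in> ?G" unfolding z_def
      by (intro vec.subspace_scale vec.subspace_diff subspace_generalized_eigenspace w u)
    moreover have "(B - mat a) *v z = w"
    proof -
      have "(B - mat a) *v (w - u) = (B - mat a) *v w - (B - mat \<nu>) *v w"
        using u by (simp add: matrix_vector_mult_diff_distrib)
      also have "\<dots> = (\<nu> - a) *s w" by (simp add: diff_mat_mult_vec vec.scale_left_diff_distrib)
      finally show ?thesis using ne
        unfolding z_def vector_scalar_commute by (simp only: vector_smult_assoc) simp
    qed
    ultimately show ?case by blast
  qed
qed

text \<open>With \<open>S\<close> the span, every \<open>w \<in> S\<close> is \<open>(B - a) u\<close> for some \<open>u \<in> S\<close>, up to an error
  in the generalized eigenspace of \<open>a\<close>. For \<open>w = (B - a) x\<close> this puts \<open>x - u\<close> there.\<close>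

lemma span_generalized_eigenspaces_step:
  fixes B :: "complex^'n^'n"
  defines "S \<equiv> vec.span (\<Union>\<mu>. generalized_eigenspace B \<mu>)"
  assumes "(B - mat a) *v x \<in> S"
  shows "x \<in> S"
proof -
  let ?P = "\<lambda>w. \<exists>u\<in>S. w - (B - mat a) *v u \<in> generalized_eigenspace B a"
  have "?P w" if "w \<in> S" for w
    using that unfolding S_def
  proof (rule vec.span_induct, fold S_def)
    show "vec.subspace (Collect ?P)"
    proof (rule vec.subspaceI)
      show "0 \<in> Collect ?P"
        using vec.subspace_0[OF subspace_generalized_eigenspace] 
        by (auto intro!: bexI[of _ 0] simp: S_def vec.span_zero)
    next
      fix x y assume "x \<in> Collect ?P" "y \<in> Collect ?P"
      then obtain u v where "u \<in> S" "v \<in> S"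
        "x - (B - mat a) *v u \<in> generalized_eigenspace B a"
        "y - (B - mat a) *v v \<in> generalized_eigenspace B a" by auto
      moreover from this have "u + v \<in> S" by (simp add: S_def vec.span_add)
      ultimately show "x + y \<in> Collect ?P"
        using vec.subspace_add[OF subspace_generalized_eigenspace, of "x - (B - mat a) *v u" B a "y - (B - mat a) *v v"]
        by (auto intro!: bexI[of _ "u + v"] simp: matrix_vector_right_distrib algebra_simps)
    next
      fix c x assume "x \<in> Collect ?P"
      then obtain u where "u \<in> S" "x - (B - mat a) *v u \<in> generalized_eigenspace B a" by auto
      moreover from this have "c *s u \<in> S" by (simp add: S_def vec.span_scale)
      ultimately show "c *s x \<in> Collect ?P"
        using vec.subspace_scale[OF subspace_generalized_eigenspace, of "x - (B - mat a) *v u" B a c]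
        by (auto intro!: bexI[of _ "c *s u"] simp: vector_scalar_commute vec.scale_right_diff_distrib)
    qed
  next
    fix w assume "w \<in> (\<Union>\<mu>. generalized_eigenspace B \<mu>)"
    then obtain \<nu> where \<nu>: "w \<in> generalized_eigenspace B \<nu>" by blast
    show "?P w"
    proof (cases "\<nu> = a")
      case True
      then show ?thesis using \<nu> by (intro bexI[of _ 0]) (simp_all add: S_def vec.span_zero)
    next
      case False
      then obtain u where u: "u \<in> generalized_eigenspace B \<nu>" "(B - mat a) *v u = w"
        using generalized_eigenspace_solve[OF _ \<nu>] by blast
      then have "u \<in> S" unfolding S_def by (intro vec.span_base) blast
      then show ?thesis using u vec.subspace_0[OF subspace_generalized_eigenspace, of B a]
        by (auto intro!: bexI[of _ u])
    qed
  qed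
  from this[OF assms(2)] obtain u where u: "u \<in> S"
    "(B - mat a) *v (x - u) \<in> generalized_eigenspace B a"
    by (auto simp: matrix_vector_mult_diff_distrib)
  then have "x - u \<in> S"
    unfolding S_def by (intro vec.span_base) (blast intro: generalized_eigenspace_step)
  then have "x - u + u \<in> S" using u(1) unfolding S_def by (rule vec.span_add)
  then show ?thesis by simp
qed

section \<open>Polynomials in a matrix, acting on a vector by Horner's scheme\<close>

definition poly_apply :: "complex^'n^'n \<Rightarrow> complex poly \<Rightarrow> complex^'n \<Rightarrow> complex^'n" where
  "poly_apply B p v = fold_coeffs (\<lambda>c w. c *s v + B *v w) p 0"

lemma poly_apply_0 [simp]: "poly_apply B 0 v = 0"
  by (simp add: poly_apply_def)

lemma poly_apply_pCons [simp]: "poly_apply B (pCons c p) v = c *s v + B *v poly_apply B p v"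
  by (cases "p = 0 \<and> c = 0") (auto simp: poly_apply_def)

lemma poly_apply_add: "poly_apply B (p + q) v = poly_apply B p v + poly_apply B q v"
  by (induction p q rule: poly_induct2)
    (simp_all add: matrix_vector_right_distrib vec.scale_left_distrib)

lemma poly_apply_smult: "poly_apply B (smult c p) v = c *s poly_apply B p v"
  by (induction p) (simp_all add: vector_scalar_commute vec.scale_right_distrib)

lemma poly_apply_diff: "poly_apply B (p - q) v = poly_apply B p v - poly_apply B q v"
  using poly_apply_add[of B "p - q" q v] by (simp add: algebra_simps)

lemma poly_apply_monom: "poly_apply B (monom 1 i) v = ((*v) B ^^ i) v"
  by (induction i) (simp_all add: monom_Suc monom_0 del: One_nat_def monom_eq_1)

text \<open>\<open>B - mat a\<close> commutes with every polynomial in \<open>B\<close>, so a linear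
  factor can be moved onto the vector.\<close>

lemma poly_apply_linear_factor:
  "poly_apply B ([:- a, 1:] * q) v = poly_apply B q ((B - mat a) *v v)"
proof -
  have "poly_apply B q ((B - mat a) *v v) = (B - mat a) *v poly_apply B q v"
  proof (induction q)
    case (pCons c q)
    have "B *v ((B - mat a) *v w) = (B - mat a) *v (B *v w)" for w
      by (simp only: diff_mat_mult_vec matrix_vector_mult_diff_distrib vector_scalar_commute)
    with pCons.IH show ?case
      by (simp only: poly_apply_pCons matrix_vector_right_distrib vector_scalar_commute)
  qed simp
  then show ?thesis
    by (simp add: poly_apply_diff poly_apply_smult diff_mat_mult_vec)
qed

lemma poly_apply_sum: "poly_apply B (\<Sum>i\<in>S. p i) v = (\<Sum>i\<in>S. poly_apply B (p i) v)"
  by (induction S rule: infinite_finite_induct) (simp_all add: poly_apply_add)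

lemma poly_apply_linear_power:
  "poly_apply B ([:- a, 1:] ^ i * q) v = poly_apply B q (((*v) (B - mat a) ^^ i) v)"
proof (induction i arbitrary: v)
  case (Suc i)
  have "poly_apply B ([:- a, 1:] ^ Suc i * q) v = poly_apply B ([:- a, 1:] * ([:- a, 1:] ^ i * q)) v"
    by (simp only: power_Suc mult.assoc)
  also have "\<dots> = poly_apply B q (((*v) (B - mat a) ^^ i) ((B - mat a) *v v))"
    by (simp only: poly_apply_linear_factor Suc.IH)
  finally show ?case by (simp only: funpow_Suc_right comp_apply)
qed simp

lemma annihilating_poly_exists:
  fixes B :: "complex^'n^'n"
  shows "\<exists>q. q \<noteq> 0 \<and> poly_apply B q v = 0"
proof -
  define K where "K d = (\<lambda>i. ((*v) B ^^ i) v) ` {..<d}" for d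
  have "\<exists>d. ((*v) B ^^ d) v \<in> vec.span (K d)"
  proof (rule ccontr)
    assume no: "\<not> ?thesis"
    have "vec.independent (K d) \<and> card (K d) = d" for d
    proof (induction d)
      case 0
      then show ?case by (simp add: K_def vec.independent_empty)
    next
      case (Suc d)
      have K: "K (Suc d) = insert (((*v) B ^^ d) v) (K d)" by (auto simp: K_def lessThan_Suc)
      have "((*v) B ^^ d) v \<notin> K d" using no vec.span_base by blast
      then show ?case using Suc no unfolding K
        by (auto simp: vec.independent_insert) (simp add: K_def)
    qed
    from this[of "Suc CARD('n)"] show False
      using vec.independent_card_le_dim[of "K (Suc CARD('n))" UNIV] by (auto simp: vec.dim_UNIV card_cart_basis)
  qed
  then obtain d where d: "((*v) B ^^ d) v \<in> vec.span (K d)" by blast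
  \<comment> \<open>Bounding the coefficients of \<open>p\<close> below index \<open>d\<close>
    ensures that \<open>monom 1 d - p\<close> has coefficient 1 at \<open>d\<close> and so is not
    0.\<close>
  let ?P = "\<lambda>w. \<exists>p. (\<forall>i\<ge>d. coeff p i = 0) \<and> poly_apply B p v = w"
  have "?P (((*v) B ^^ d) v)"
    using d
  proof (rule vec.span_induct_alt)
    show "?P 0" by (rule exI[of _ 0]) simp
  next
    fix c x y assume "x \<in> K d" "?P y"
    then obtain i p where "i < d" "x = ((*v) B ^^ i) v"
      "\<forall>i\<ge>d. coeff p i = 0" "poly_apply B p v = y" by (auto simp: K_def)
    then show "?P (c *s x + y)"
      by (intro exI[of _ "smult c (monom 1 i) + p"])
        (auto simp: poly_apply_add poly_apply_smult poly_apply_monom)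
  qed
  then obtain p where p: "\<forall>i\<ge>d. coeff p i = 0" "poly_apply B p v = ((*v) B ^^ d) v" by blast
  have "coeff (monom 1 d - p) d = 1" using p by simp
  then have "monom 1 d - p \<noteq> 0" by (metis coeff_0 zero_neq_one)
  moreover have "poly_apply B (monom 1 d - p) v = 0" using p by (simp add: poly_apply_diff poly_apply_monom)
  ultimately show ?thesis by blast
qed

text \<open>Induction on the degree of a polynomial annihilating \<open>v\<close>. Splitting off a
  root \<open>a\<close> leaves a factor that annihilates \<open>(B - mat a) *v v\<close>, and
  \<open>span_generalized_eigenspaces_step\<close> pulls membership in the span back to
  \<open>v\<close>.\<close>

lemma span_generalized_eigenspaces:
  fixes B :: "complex^'n^'n"
  shows "v \<in> vec.span (\<Union>\<mu>. generalized_eigenspace B \<mu>)"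
proof -
  have "v \<in> vec.span (\<Union>\<mu>. generalized_eigenspace B \<mu>)"
    if "poly_apply B q v = 0" "q \<noteq> 0" for q
    using that
  proof (induction "degree q" arbitrary: q v)
    case 0
    then obtain c where "q = [:c:]" by (metis degree_eq_zeroE)
    with 0 show ?case by (auto simp: vec.span_zero)
  next
    case (Suc d)
    then have "\<not> constant (poly q)" by (simp add: constant_degree)
    then obtain a where "poly q a = 0" using fundamental_theorem_of_algebra by blast
    then obtain r where r: "q = [:- a, 1:] * r" by (metis dvdE poly_eq_0_iff_dvd)
    with Suc.prems have nz: "r \<noteq> 0" by auto
    then have "degree q = Suc (degree r)" unfolding r by (subst degree_mult_eq) auto
    then have "(B - mat a) *v v \<in> vec.span (\<Union>\<mu>. generalized_eigenspace B \<mu>)"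
      using Suc nz r by (intro Suc.hyps(1)[of r]) (simp_all only: poly_apply_linear_factor nat.inject not_False_eq_True)
    then show ?case by (rule span_generalized_eigenspaces_step)
  qed
  then show ?thesis using annihilating_poly_exists by blast
qed


section \<open>Asymptotics of matrix powers\<close>

text \<open>The binomial theorem for the commuting matrices \<open>B - a\<close> and \<open>a\<close>, read off from the one
  for polynomials.\<close>

lemma funpow_binomial:
  fixes B :: "complex^'n^'n"
  shows "((*v) B ^^ t) v =
    (\<Sum>i\<le>t. (of_nat (t choose i) * a ^ (t - i)) *s (((*v) (B - mat a) ^^ i) v))"
proof -
  have "monom 1 t = ([:- a, 1:] + [:a:]) ^ t"
    by (simp add: monom_altdef)
  also have "\<dots> = (\<Sum>i\<le>t. of_nat (t choose i) * [:- a, 1:] ^ i * [:a:] ^ (t - i))"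
    by (rule binomial_ring)
  also have "\<dots> = (\<Sum>i\<le>t. [:- a, 1:] ^ i * [:of_nat (t choose i) * a ^ (t - i):])"
    by (intro sum.cong refl) (simp add: poly_const_pow of_nat_poly mult_ac)
  finally show ?thesis
    by (simp only: poly_apply_sum poly_apply_linear_power poly_apply_pCons poly_apply_0
        matrix_vector_mult_0_right add_0_right flip: poly_apply_monom[of B t])
qed

text \<open>A chain of generalized eigenvectors contributes a polynomial factor in \<open>t\<close>,
  which any gap between \<open>cmod \<nu>\<close> and \<open>\<rho>\<close> absorbs. Induction along
  the chain avoids writing that polynomial down.\<close>

lemma generalized_eigenvector_growth:
  fixes B :: "complex^'n^'n"
  assumes \<rho>: "cmod \<nu> < \<rho>" and "w \<in> generalized_eigenspace B \<nu>"
  shows "\<exists>C. \<forall>t. norm (((*v) B ^^ t) w) \<le> C * \<rho> ^ t"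
proof -
  obtain m where "((*v) (B - mat \<nu>) ^^ m) w = 0"
    using assms by (auto simp: generalized_eigenspace_def)
  then show ?thesis
  proof (induction m arbitrary: w)
    case 0
    then show ?case by (auto intro!: exI[of _ 0])
  next
    case (Suc m)
    let ?w = "(B - mat \<nu>) *v w"
    have "((*v) (B - mat \<nu>) ^^ m) ?w = 0" using Suc.prems by (simp add: funpow_swap1)
    from Suc.IH[OF this] obtain C' where C': "norm (((*v) B ^^ t) ?w) \<le> C' * \<rho> ^ t" for t by blast
    \<comment> \<open>The first entry covers \<open>t = 0\<close>; the second is what makes
      \<open>C' + cmod \<nu> * C \<le> \<rho> * C\<close>, the bound that carries the induction on
      \<open>t\<close>.\<close>
    define C where "C = max (norm w) (C' / (\<rho> - cmod \<nu>))"
    have "C' / (\<rho> - cmod \<nu>) \<le> C" by (simp add: C_def)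
    then have C: "C' + cmod \<nu> * C \<le> \<rho> * C" using \<rho> by (simp add: divide_le_eq algebra_simps)
    have "\<rho> > 0" using \<rho> norm_ge_zero[of \<nu>] by linarith
    have "norm (((*v) B ^^ t) w) \<le> C * \<rho> ^ t" for t
    proof (induction t)
      case (Suc t)
      have "B *v w = ?w + \<nu> *s w" by (simp add: diff_mat_mult_vec)
      then have "((*v) B ^^ Suc t) w = ((*v) B ^^ t) ?w + \<nu> *s ((*v) B ^^ t) w"
        by (simp only: funpow_Suc_right comp_apply funpow_matrix_add funpow_matrix_smult)
      then have "norm (((*v) B ^^ Suc t) w) \<le> C' * \<rho> ^ t + cmod \<nu> * (C * \<rho> ^ t)"
        using C'[of t] Suc mult_left_mono[OF Suc, of "cmod \<nu>"]
        by (metis (no_types, lifting) add_mono norm_ge_zero norm_smult_vec norm_triangle_mono)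
      also have "\<dots> = (C' + cmod \<nu> * C) * \<rho> ^ t" by (simp add: algebra_simps)
      also have "\<dots> \<le> \<rho> * C * \<rho> ^ t" using C \<open>\<rho> > 0\<close> by (intro mult_right_mono) auto
      finally show ?case by (simp add: mult_ac)
    qed (simp add: C_def)
    then show ?case by blast
  qed
qed

text \<open>The last nonzero vector of the chain is an eigenvector. It gives the limit direction for
  the dominant eigenvalue and shows that the other \<nu> in question are true eigenvalues.\<close>

lemma generalized_eigenspace_height:
  assumes "w \<in> generalized_eigenspace B \<nu>" "w \<noteq> 0"
  obtains s where "((*v) (B - mat \<nu>) ^^ s) w \<noteq> 0" "((*v) (B - mat \<nu>) ^^ Suc s) w = 0"
proof -
  let ?P = "\<lambda>m. ((*v) (B - mat \<nu>) ^^ m) w = 0"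
  obtain m where "?P m" using assms by (auto simp: generalized_eigenspace_def)
  moreover have "\<not> ?P 0" using assms by simp
  ultimately obtain s where "\<not> ?P s" "?P (Suc s)" using ex_least_nat_less[of ?P m] by blast
  with that show thesis by blast
qed

text \<open>By the absorption identities the quotient is \<open>(i + 1) / (t - i)\<close> once
  \<open>t > i\<close>; for smaller \<open>t\<close> its denominator is 0.\<close>

lemma binomial_step_tendsto_0: "(\<lambda>t. real (t choose i) / real (t choose Suc i)) \<longlonglongrightarrow> 0"
proof (rule Lim_transform_eventually)
  show "(\<lambda>t. real (Suc i) / (real t - real i)) \<longlonglongrightarrow> 0" by real_asymp
  show "\<forall>\<^sub>F t in sequentially. real (Suc i) / (real t - real i) = real (t choose i) / real (t choose Suc i)"
    using eventually_gt_at_top[of i]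
  proof eventually_elim
    case (elim t)
    have "Suc i * (t choose Suc i) = (t - i) * (t choose i)"
      by (simp only: binomial_absorption binomial_absorb_comp)
    then have "real (Suc i) * real (t choose Suc i) = (real t - real i) * real (t choose i)"
      using elim by (metis less_imp_le of_nat_diff of_nat_mult)
    then show ?case using elim by (simp add: frac_eq_eq mult_ac)
  qed
qed

text \<open>Raising \<open>s\<close> by one multiplies the ratio by one with adjacent lower indices;
  the cancelled \<open>t choose s\<close> is nonzero for \<open>t \<ge> s\<close>.\<close>

lemma binomial_ratio_tendsto_0:
  "i < s \<Longrightarrow> (\<lambda>t. real (t choose i) / real (t choose s)) \<longlonglongrightarrow> 0"
proof (induction s)
  case (Suc s)
  show ?case
  proof (cases "i = s")
    case True
    then show ?thesis using binomial_step_tendsto_0 by simp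
  next
    case False
    then have "(\<lambda>t. real (t choose i) / real (t choose s) * (real (t choose s) / real (t choose Suc s))) \<longlonglongrightarrow> 0"
      using Suc by (intro tendsto_mult_zero binomial_step_tendsto_0) simp
    moreover have "\<forall>\<^sub>F t in sequentially. real (t choose i) / real (t choose s) * (real (t choose s) / real (t choose Suc s)) = real (t choose i) / real (t choose Suc s)"
      using eventually_ge_at_top[of s] by eventually_elim simp
    ultimately show ?thesis by (rule Lim_transform_eventually)
  qed
qed simp

text \<open>In the binomial expansion about \<mu> the terms with \<open>i > s\<close> vanish, those
  with \<open>i < s\<close> are outgrown by \<open>t choose s\<close>, and only \<open>i = s\<close>
  survives.\<close>

lemma generalized_eigenvector_direction:
  fixes B :: "complex^'n^'n"
  assumes \<mu>: "\<mu> \<noteq> 0" and "((*v) (B - mat \<mu>) ^^ Suc s) v = 0"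
  shows "(\<lambda>t. (1 / (\<mu> ^ t * of_nat (t choose s))) *s ((*v) B ^^ t) v)
    \<longlonglongrightarrow> (1 / \<mu> ^ s) *s ((*v) (B - mat \<mu>) ^^ s) v"
proof -
  let ?N = "\<lambda>i. ((*v) (B - mat \<mu>) ^^ i) v"
  let ?c = "\<lambda>t i. of_real (real (t choose i) / real (t choose s)) * (1 / \<mu> ^ i)"
  have N0: "?N i = 0" if "i > s" for i
    by (rule funpow_zero_mono[OF assms(2)]) (use that in simp)
  have "(\<lambda>t. \<Sum>i\<le>s. ?c t i *s ?N i)
      \<longlonglongrightarrow> (\<Sum>i\<le>s. (of_real (if i = s then 1 else 0) * (1 / \<mu> ^ i)) *s ?N i)"
  proof (intro tendsto_intros)
    fix i assume "i \<in> {..s}"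
    show "(\<lambda>t. real (t choose i) / real (t choose s)) \<longlonglongrightarrow> (if i = s then 1 else 0)"
    proof (cases "i = s")
      case True
      have "\<forall>\<^sub>F t in sequentially. 1 = real (t choose s) / real (t choose s)"
        using eventually_ge_at_top[of s] by eventually_elim simp
      then show ?thesis using True by (auto intro: Lim_transform_eventually[OF tendsto_const])
    next
      case False
      then show ?thesis using \<open>i \<in> {..s}\<close> by (simp add: binomial_ratio_tendsto_0)
    qed
  qed
  also have "(\<Sum>i\<le>s. (of_real (if i = s then 1 else 0) * (1 / \<mu> ^ i)) *s ?N i)
      = (\<Sum>i\<le>s. if i = s then (1 / \<mu> ^ i) *s ?N i else 0)"
    by (intro sum.cong) auto
  also have "\<dots> = (1 / \<mu> ^ s) *s ?N s" by simp
  finally have lim: "(\<lambda>t. \<Sum>i\<le>s. ?c t i *s ?N i) \<longlonglongrightarrow> (1 / \<mu> ^ s) *s ?N s" .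
  have "\<forall>\<^sub>F t in sequentially. (\<Sum>i\<le>s. ?c t i *s ?N i)
      = (1 / (\<mu> ^ t * of_nat (t choose s))) *s ((*v) B ^^ t) v"
    using eventually_ge_at_top[of s]
  proof eventually_elim
    case (elim t)
    have "(1 / (\<mu> ^ t * of_nat (t choose s))) *s ((*v) B ^^ t) v
        = (\<Sum>i\<le>t. (1 / (\<mu> ^ t * of_nat (t choose s)) * (of_nat (t choose i) * \<mu> ^ (t - i))) *s ?N i)"
      by (simp only: funpow_binomial[of t B v \<mu>] vec.scale_sum_right vector_smult_assoc)
    also have "\<dots> = (\<Sum>i\<le>t. ?c t i *s ?N i)"
      by (intro sum.cong refl arg_cong2[of _ _ _ _ "(*s)"]) (use \<mu> in \<open>simp add: power_diff field_simps\<close>)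
    also have "\<dots> = (\<Sum>i\<le>s. ?c t i *s ?N i)"
      using elim by (intro sum.mono_neutral_right) (auto simp: N0)
    finally show ?case by simp
  qed
  with lim show ?thesis by (rule Lim_transform_eventually)
qed

lemma power_subdominant_tendsto_0:
  fixes B :: "complex^'n^'n"
  assumes \<mu>: "\<mu> \<noteq> 0"
    and dom: "\<And>\<nu> u. u \<noteq> 0 \<Longrightarrow> B *v u = \<nu> *s u \<Longrightarrow> \<nu> \<noteq> \<mu> \<Longrightarrow> cmod \<nu> < cmod \<mu>"
    and w: "w \<in> vec.span (\<Union>\<nu>\<in>- {\<mu>}. generalized_eigenspace B \<nu>)"
  shows "(\<lambda>t. (1 / \<mu> ^ t) *s ((*v) B ^^ t) w) \<longlonglongrightarrow> 0"
  using w
proof (rule vec.span_induct_alt)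
  fix c x y
  assume "x \<in> (\<Union>\<nu>\<in>- {\<mu>}. generalized_eigenspace B \<nu>)"
    and y: "(\<lambda>t. (1 / \<mu> ^ t) *s ((*v) B ^^ t) y) \<longlonglongrightarrow> 0"
  then obtain \<nu> where \<nu>: "\<nu> \<noteq> \<mu>" "x \<in> generalized_eigenspace B \<nu>" by blast
  have x: "(\<lambda>t. (1 / \<mu> ^ t) *s ((*v) B ^^ t) x) \<longlonglongrightarrow> 0"
  proof (cases "x = 0")
    case False
    \<comment> \<open>\<open>dom\<close> speaks of eigenvectors only; the end of the chain of
      \<open>x\<close> is one, so it applies to \<nu>.\<close>
    then obtain s where s: "((*v) (B - mat \<nu>) ^^ s) x \<noteq> 0" "((*v) (B - mat \<nu>) ^^ Suc s) x = 0"
      using generalized_eigenspace_height[OF \<nu>(2)] by blast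
    then have "B *v (((*v) (B - mat \<nu>) ^^ s) x) = \<nu> *s (((*v) (B - mat \<nu>) ^^ s) x)"
      by (simp add: diff_mat_mult_vec)
    with s(1) have "cmod \<nu> < cmod \<mu>" using \<nu>(1) dom by blast
    then obtain \<rho> where \<rho>: "cmod \<nu> < \<rho>" "\<rho> < cmod \<mu>" using dense by blast
    obtain C where C: "norm (((*v) B ^^ t) x) \<le> C * \<rho> ^ t" for t
      using generalized_eigenvector_growth[OF \<rho>(1) \<nu>(2)] by blast
    have "\<rho> > 0" using \<rho> norm_ge_zero[of \<nu>] by linarith
    then have "norm (\<rho> / cmod \<mu>) < 1" using \<rho> \<mu> by simp
    then have lim: "(\<lambda>t. C * (\<rho> / cmod \<mu>) ^ t) \<longlonglongrightarrow> 0"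
      by (intro tendsto_mult_right_zero LIMSEQ_power_zero)
    have bd: "\<forall>t. norm ((1 / \<mu> ^ t) *s ((*v) B ^^ t) x) \<le> C * (\<rho> / cmod \<mu>) ^ t"
      using C by (simp add: norm_smult_vec norm_divide norm_power power_divide divide_right_mono)
    show ?thesis by (rule Lim_null_comparison[OF always_eventually[OF bd] lim])
  qed simp
  have "(\<lambda>t. c *s ((1 / \<mu> ^ t) *s ((*v) B ^^ t) x) + (1 / \<mu> ^ t) *s ((*v) B ^^ t) y) \<longlonglongrightarrow> c *s 0 + 0"
    by (intro tendsto_intros x y)
  then show "(\<lambda>t. (1 / \<mu> ^ t) *s ((*v) B ^^ t) (c *s x + y)) \<longlonglongrightarrow> 0"
    by (simp add: funpow_matrix_add funpow_matrix_smult vec.scale_right_distrib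
        vector_smult_assoc mult.commute)
qed simp

text \<open>A vector killed by a power of \<open>B\<close> lies in the generalized eigenspace of 0,
  one of the excluded ones because \<open>\<mu> \<noteq> 0\<close>.\<close>

lemma power_iteration_nonzero:
  fixes B :: "complex^'n^'n"
  assumes \<mu>: "\<mu> \<noteq> 0"
    and v: "v \<notin> vec.span (\<Union>\<nu>\<in>- {\<mu>}. generalized_eigenspace B \<nu>)"
  shows "((*v) B ^^ t) v \<noteq> 0"
proof
  assume "((*v) B ^^ t) v = 0"
  moreover have "(*v) (B - mat 0) = (*v) B" by (simp add: fun_eq_iff diff_mat_mult_vec)
  ultimately have "((*v) (B - mat 0) ^^ t) v = 0" by (simp only:)
  then have "v \<in> generalized_eigenspace B 0"
    unfolding generalized_eigenspace_def by blast
  with \<mu> have "v \<in> (\<Union>\<nu>\<in>- {\<mu>}. generalized_eigenspace B \<nu>)" by (intro UN_I[of 0]) simp_all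
  with v show False by (simp only: vec.span_base not_True_eq_False)
qed

lemma power_iteration_direction:
  fixes B :: "complex^'n^'n"
  assumes \<mu>: "\<mu> \<noteq> 0"
    and dom: "\<And>\<nu> u. u \<noteq> 0 \<Longrightarrow> B *v u = \<nu> *s u \<Longrightarrow> \<nu> \<noteq> \<mu> \<Longrightarrow> cmod \<nu> < cmod \<mu>"
    and v: "v \<notin> vec.span (\<Union>\<nu>\<in>- {\<mu>}. generalized_eigenspace B \<nu>)"
  shows "\<exists>u c. norm u = 1 \<and> B *v u = \<mu> *s u \<and> (\<forall>t. cmod (c t) = 1) \<and>
    (\<lambda>t. c t *s sgn (((*v) B ^^ t) v)) \<longlonglongrightarrow> u"
proof -
  let ?R = "\<Union>\<nu>\<in>- {\<mu>}. generalized_eigenspace B \<nu>"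
  have "(\<Union>\<nu>. generalized_eigenspace B \<nu>) = generalized_eigenspace B \<mu> \<union> ?R" by auto
  then have "v \<in> vec.span (generalized_eigenspace B \<mu> \<union> ?R)"
    using span_generalized_eigenspaces[of v B] by simp
  then obtain v1 w where vw: "v = v1 + w" and "v1 \<in> vec.span (generalized_eigenspace B \<mu>)"
    and w: "w \<in> vec.span ?R"
    by (auto simp: vec.span_Un)
  then have v1: "v1 \<in> generalized_eigenspace B \<mu>"
    by (metis vec.span_eq_iff subspace_generalized_eigenspace)
  \<comment> \<open>Otherwise \<open>v = w\<close> would lie in the excluded span.\<close>
  have "v1 \<noteq> 0" using v w vw by auto
  then obtain s where s: "((*v) (B - mat \<mu>) ^^ s) v1 \<noteq> 0" "((*v) (B - mat \<mu>) ^^ Suc s) v1 = 0"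
    using generalized_eigenspace_height[OF v1] by blast
  define g where "g t = \<mu> ^ t * of_nat (t choose s)" for t
  define u where "u = (1 / \<mu> ^ s) *s ((*v) (B - mat \<mu>) ^^ s) v1"
  have "u \<noteq> 0" using s \<mu> by (simp add: u_def)
  have Bu: "B *v u = \<mu> *s u"
    using s(2) by (simp add: u_def diff_mat_mult_vec vector_scalar_commute vector_smult_assoc mult.commute)
  \<comment> \<open>The binomial coefficient is at least 1 for \<open>t \<ge> s\<close>, so dividing
    by it keeps the limit 0.\<close>
  have "(\<lambda>t. (1 / of_nat (t choose s)) *s ((1 / \<mu> ^ t) *s ((*v) B ^^ t) w)) \<longlonglongrightarrow> 0"
  proof (rule Lim_null_comparison)
    show "\<forall>\<^sub>F t in sequentially. norm ((1 / of_nat (t choose s)) *s ((1 / \<mu> ^ t) *s ((*v) B ^^ t) w))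
        \<le> norm ((1 / \<mu> ^ t) *s ((*v) B ^^ t) w)"
      using eventually_ge_at_top[of s]
    proof eventually_elim
      case (elim t)
      then have "real (t choose s) \<ge> 1" by (simp add: Suc_le_eq)
      then have "1 / real (t choose s) \<le> 1" by (subst pos_divide_le_eq) linarith+
      then show ?case
        by (metis (no_types, opaque_lifting) mult_left_le_one_le norm_divide norm_ge_zero norm_of_nat norm_one norm_smult_vec)
    qed
    show "(\<lambda>t. norm ((1 / \<mu> ^ t) *s ((*v) B ^^ t) w)) \<longlonglongrightarrow> 0"
      using power_subdominant_tendsto_0[OF \<mu> dom w] by (rule tendsto_norm_zero)
  qed
  then have "(\<lambda>t. (1 / g t) *s ((*v) B ^^ t) v1 + (1 / g t) *s ((*v) B ^^ t) w) \<longlonglongrightarrow> u + 0"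
    unfolding g_def u_def
    by (intro tendsto_add generalized_eigenvector_direction \<mu> s) (simp add: vector_smult_assoc mult.commute)
  then have "(\<lambda>t. (1 / g t) *s ((*v) B ^^ t) v) \<longlonglongrightarrow> u"
    by (simp add: vw funpow_matrix_add vec.scale_right_distrib)
  \<comment> \<open>Normalization is continuous away from 0 and discards the modulus of
    \<open>g t\<close>, leaving only a phase for \<open>c\<close>.\<close>
  then have lim: "(\<lambda>t. sgn ((1 / g t) *s ((*v) B ^^ t) v)) \<longlonglongrightarrow> sgn u"
    using \<open>u \<noteq> 0\<close> by (rule tendsto_sgn)
  \<comment> \<open>\<open>g t = 0\<close> for \<open>t < s\<close>, where the binomial coefficient vanishes\<close>
  define c where "c t = (if g t = 0 then 1 else sgn (1 / g t))" for t
  have "\<forall>\<^sub>F t in sequentially. sgn ((1 / g t) *s ((*v) B ^^ t) v) = c t *s sgn (((*v) B ^^ t) v)"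
    using eventually_ge_at_top[of s]
    by eventually_elim (use \<mu> in \<open>simp add: c_def g_def sgn_smult_vec\<close>)
  with lim have "(\<lambda>t. c t *s sgn (((*v) B ^^ t) v)) \<longlonglongrightarrow> sgn u" by (rule Lim_transform_eventually)
  moreover have "cmod (c t) = 1" for t by (simp add: c_def norm_sgn norm_divide)
  moreover have "norm (sgn u) = 1" using \<open>u \<noteq> 0\<close> by (simp add: norm_sgn)
  moreover have "B *v sgn u = \<mu> *s sgn u"
    using Bu by (simp add: sgn_vec_smult vector_scalar_commute vector_smult_assoc mult.commute)
  ultimately show ?thesis by blast
qed


section \<open>Fourier blocks of the power method\<close>

lemma hat_uminus: "j < CARD('k) \<Longrightarrow> hat (- a :: 'k::finite circulant) j = - hat a j"
  using hat_minus[of j 0 a] by (simp add: hat_zero)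

lemma hat_prod: "j < CARD('k) \<Longrightarrow> hat (prod f S :: 'k::finite circulant) j = (\<Prod>s\<in>S. hat (f s) j)"
  by (induction S rule: infinite_finite_induct) (auto simp: hat_one hat_times)

text \<open>Taking a Fourier coefficient is a ring homomorphism and so passes through the Leibniz
  expansion; the only constants in it are the signs.\<close>

lemma hat_det:
  fixes M :: "('k::finite circulant)^'n^'n"
  assumes j: "j < CARD('k)"
  shows "hat (det M) j = det (hat_mat M j)"
proof -
  have "hat (of_int (sign p) :: 'k circulant) j = of_int (sign p)" for p :: "'n \<Rightarrow> 'n"
    using j by (cases p rule: sign_cases) (simp_all add: hat_one hat_uminus)
  then show ?thesis
    using j by (simp add: Determinants.det_def hat_sum hat_times hat_prod hat_mat_def)
qed

lemma hat_mat_diff_mat: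
  fixes A :: "('k::finite circulant)^'n^'n"
  assumes "j < CARD('k)"
  shows "hat_mat (A - mat l) j = hat_mat A j - mat (hat l j)"
  using assms
  by (simp add: hat_mat_def Finite_Cartesian_Product.mat_def
      Finite_Cartesian_Product.vec_eq_iff hat_minus hat_zero)

lemma hat_vec_mult:
  fixes A :: "('k::finite circulant)^'n^'m"
  assumes "j < CARD('k)"
  shows "hat_vec (A *v x) j = hat_mat A j *v hat_vec x j"
  using assms by (simp add: hat_vec_def hat_mat_def matrix_vector_mult_def hat_sum hat_times)

lemma hat_vec_smult:
  fixes x :: "('k::finite circulant)^'n"
  assumes "j < CARD('k)"
  shows "hat_vec (a *s x) j = hat a j *s hat_vec x j"
  using assms by (simp add: hat_vec_def hat_times Finite_Cartesian_Product.vec_eq_iff)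

lemma hat_vec_diff:
  fixes x :: "('k::finite circulant)^'n"
  assumes "j < CARD('k)"
  shows "hat_vec (x - y) j = hat_vec x j - hat_vec y j"
  using assms by (simp add: hat_vec_def hat_minus Finite_Cartesian_Product.vec_eq_iff)

lemma hat_vec_nth: "hat_vec x j $ p = hat (x $ p) j"
  by (simp add: hat_vec_def)

lemma hat_vec_inj:
  fixes x y :: "('k::finite circulant)^'n"
  assumes "\<And>j. j < CARD('k) \<Longrightarrow> hat_vec x j = hat_vec y j"
  shows "x = y"
  using assms
  by (auto simp: Finite_Cartesian_Product.vec_eq_iff hat_vec_def intro!: hat_inj)

lemma hat_vec_surj: "\<exists>x :: ('k::finite circulant)^'n. \<forall>j<CARD('k). hat_vec x j = f j"
proof -
  have "\<exists>a :: 'k circulant. \<forall>j<CARD('k). hat a j = f j $ i" for i by (rule hat_surj)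
  then obtain a :: "'n \<Rightarrow> 'k circulant" where "\<forall>i. \<forall>j<CARD('k). hat (a i) j = f j $ i" by metis
  then show ?thesis
    by (intro exI[of _ "\<chi> i. a i"]) (simp add: hat_vec_def Finite_Cartesian_Product.vec_eq_iff)
qed

section \<open>Eigenvalues of the ring and of the blocks\<close>

lemma keigenvalue_iff:
  fixes A :: "('k::finite circulant)^'n^'n"
  shows "keigenvalue A l \<longleftrightarrow> (\<forall>j<CARD('k). det (hat_mat A j - mat (hat l j)) = 0)"
  unfolding keigenvalue_def hat_eq_iff by (simp add: hat_det hat_mat_diff_mat hat_zero)

lemma det_eq_0_eigenvector:
  fixes B :: "complex^'n^'n"
  assumes "u \<noteq> 0" "B *v u = \<nu> *s u"
  shows "det (B - mat \<nu>) = 0"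
proof -
  have "(B - mat \<nu>) *v u = 0" using assms by (simp add: diff_mat_mult_vec)
  then show ?thesis
    using assms(1) invertible_det_nz[of "B - mat \<nu>"] matrix_left_invertible_ker[of "B - mat \<nu>"]
    unfolding invertible_def by metis
qed

lemma kle_kabs_iff:
  "kle (kabs a) (kabs (b :: 'k::finite circulant)) \<longleftrightarrow> (\<forall>j<CARD('k). cmod (hat a j) \<le> cmod (hat b j))"
  by (simp add: kle_def hat_kabs less_eq_complex_def)

lemma kless_kabs_iff:
  "kless (kabs a) (kabs (b :: 'k::finite circulant)) \<longleftrightarrow> (\<forall>j<CARD('k). cmod (hat a j) < cmod (hat b j))"
  by (simp add: kless_def hat_kabs less_complex_def)

text \<open>Blocks vary independently: \<nu> in block \<open>j\<close> together with
  \<open>lam 1\<close> in the others forms an eigenvalue over the ring. So \<nu> is a component of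
  some \<open>lam i\<close>, with \<open>i \<ge> 2\<close> by \<open>ne\<close>, and the ordering
  bounds it by \<open>lam 2\<close>.\<close>

lemma canonical_set_dominant:
  fixes A :: "('k::finite circulant)^'n^'n"
  assumes can: "canonical_set A m lam ev" and m: "m \<ge> 2"
    and less: "kless (kabs (lam 2)) (kabs (lam 1))"
    and j: "j < CARD('k)" and u: "u \<noteq> 0" "hat_mat A j *v u = \<nu> *s u" and ne: "\<nu> \<noteq> hat (lam 1) j"
  shows "cmod \<nu> < cmod (hat (lam 1) j)"
proof -
  have le: "cmod (hat (lam (2 + d)) j) \<le> cmod (hat (lam 2) j)" if "2 + d \<le> m" for d
    using that
  proof (induction d)
    case (Suc d)
    then have "kle (kabs (lam (2 + d + 1))) (kabs (lam (2 + d)))"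
      using can unfolding canonical_set_def by auto
    then show ?case using Suc j by (force simp: kle_kabs_iff)
  qed simp
  obtain l :: "'k circulant" where l: "\<forall>i<CARD('k). hat l i = (if i = j then \<nu> else hat (lam 1) i)"
    using hat_surj[of "\<lambda>i. if i = j then \<nu> else hat (lam 1) i"] by (elim exE)
  have "keigenvalue A (lam 1)"
    using can m unfolding canonical_set_def reproduces_def keigenvector_def by auto
  then have "keigenvalue A l"
    using l det_eq_0_eigenvector[OF u] by (simp add: keigenvalue_iff)
  then have "\<exists>i\<in>{1..m}. hat l j = hat (lam i) j"
    using can j unfolding canonical_set_def reproduces_def by blast
  then obtain i where i: "i \<in> {1..m}" "\<nu> = hat (lam i) j"
    using l j by auto
  with ne have "i \<noteq> 1" by auto
  with i(1) have "i = 2 + (i - 2)" "i \<le> m" by auto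
  then have "cmod \<nu> \<le> cmod (hat (lam 2) j)" using le[of "i - 2"] i(2) by simp
  also have "\<dots> < cmod (hat (lam 1) j)" using less j by (simp add: kless_kabs_iff)
  finally show ?thesis .
qed

section \<open>Normalization and iterates, block by block\<close>

lemma knorm_unit_iff:
  fixes x :: "('k::finite circulant)^'n"
  shows "knorm x dvd 1 \<longleftrightarrow> (\<forall>j<CARD('k). hat_vec x j \<noteq> 0)"
  by (auto simp: unit_iff hat_knorm)

lemma hat_vec_normalize:
  fixes x :: "('k::finite circulant)^'n"
  assumes "knorm x dvd 1" "j < CARD('k)"
  shows "hat_vec (kinv (knorm x) *s x) j = sgn (hat_vec x j)"
  using assms
  by (simp add: hat_vec_smult hat_kinv hat_knorm sgn_vec_smult)

text \<open>Normalization ignores positive factors, so the normalizations of all steps collapse into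
  a single final one.\<close>

lemma sgn_mult_sgn: "sgn (B *v sgn x) = sgn (B *v (x :: complex^'n))" for B :: "complex^'n^'m"
proof (cases "x = 0")
  case False
  then have "sgn (of_real (inverse (norm x)) :: complex) = 1"
    by (simp only: sgn_of_real) simp
  then show ?thesis
    by (simp only: sgn_vec_smult[of x] vector_scalar_commute sgn_smult_vec) simp
qed simp

lemma hat_vec_power_iterate:
  fixes A :: "('k::finite circulant)^'n^'n"
  assumes nz: "\<And>j t. j < CARD('k) \<Longrightarrow> ((*v) (hat_mat A j) ^^ t) (hat_vec x0 j) \<noteq> 0"
    and j: "j < CARD('k)"
  shows "hat_vec (power_iterate A x0 t) j = sgn (((*v) (hat_mat A j) ^^ t) (hat_vec x0 j))"
    and "hat_vec (A *v power_iterate A x0 t) j \<noteq> 0"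
proof -
  have step: "hat_mat A j *v sgn (((*v) (hat_mat A j) ^^ t) (hat_vec x0 j)) \<noteq> 0"
    if "j < CARD('k)" for j t
  proof -
    have "sgn (hat_mat A j *v sgn (((*v) (hat_mat A j) ^^ t) (hat_vec x0 j))) \<noteq> 0"
      using nz[OF that, of "Suc t"] by (simp add: sgn_mult_sgn sgn_zero_iff)
    then show ?thesis by (simp add: sgn_zero_iff)
  qed
  \<comment> \<open>All blocks go through the induction together, because a norm is a unit only if
    no block of the vector vanishes.\<close>
  have it: "\<forall>j<CARD('k). hat_vec (power_iterate A x0 t) j = sgn (((*v) (hat_mat A j) ^^ t) (hat_vec x0 j))" for t
  proof (induction t)
    case 0
    have "knorm x0 dvd 1" using nz[where t = 0] by (simp add: knorm_unit_iff)
    then show ?case by (simp add: hat_vec_normalize)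
  next
    case (Suc t)
    have "knorm (A *v power_iterate A x0 t) dvd 1"
      using step Suc by (simp add: knorm_unit_iff hat_vec_mult)
    then show ?case using Suc by (simp add: Let_def hat_vec_normalize hat_vec_mult sgn_mult_sgn)
  qed
  then show "hat_vec (power_iterate A x0 t) j = sgn (((*v) (hat_mat A j) ^^ t) (hat_vec x0 j))"
    using j by blast
  show "hat_vec (A *v power_iterate A x0 t) j \<noteq> 0"
    using it step j by (simp add: hat_vec_mult)
qed

section \<open>Convergence, angles and the stopping criterion\<close>

lemma hat_kconst:
  assumes "j < CARD('k)"
  shows "hat (kconst \<tau> :: 'k::finite circulant) j = of_real \<tau>"
  using assms by (simp add: hat_formula kconst_def if_distrib[of "\<lambda>x. x * y" for y] cong: if_cong)

lemma kless_knorm_kconst_iff: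
  fixes x :: "('k::finite circulant)^'n"
  shows "kless (knorm x) (kconst \<tau>) \<longleftrightarrow> (\<forall>j<CARD('k). norm (hat_vec x j) < \<tau>)"
  by (simp add: kless_def hat_knorm hat_kconst less_complex_def)

text \<open>Finitely many blocks admit a common threshold; hence convergence over the ring is
  blockwise convergence.\<close>

lemma eventually_all_less:
  "(\<forall>\<^sub>F t in F. \<forall>j<n. P j t) \<longleftrightarrow> (\<forall>j<n. \<forall>\<^sub>F t in F. P j t)" for n :: nat
  using eventually_ball_finite_distrib[of "{..<n}" "\<lambda>t j. P j t" F]
  by (simp only: finite_lessThan Ball_def lessThan_iff)

lemma kconverges_iff:
  fixes x :: "('k::finite circulant)^'n"
  shows "kconverges X x \<longleftrightarrow> (\<forall>j<CARD('k). (\<lambda>t. hat_vec (X t) j) \<longlonglongrightarrow> hat_vec x j)"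
  unfolding kconverges_def kless_knorm_kconst_iff eventually_all_less tendsto_iff dist_norm
  by (auto simp: hat_vec_diff)

lemma kconverges_successive:
  fixes x :: "('k::finite circulant)^'n"
  assumes "kconverges X x" "\<tau> > 0"
  shows "\<forall>\<^sub>F t in sequentially. kless (knorm (X t - X (t - 1))) (kconst \<tau>)"
  unfolding kless_knorm_kconst_iff eventually_all_less
proof (intro allI impI)
  fix j assume j: "j < CARD('k)"
  have lim: "(\<lambda>t. hat_vec (X t) j) \<longlonglongrightarrow> hat_vec x j" using assms j by (simp add: kconverges_iff)
  then have "(\<lambda>t. hat_vec (X (t - 1)) j) \<longlonglongrightarrow> hat_vec x j"
    \<comment> \<open>Shifting the index by one turns \<open>t - 1\<close> into \<open>t\<close>, so
      the truncated value at \<open>t = 0\<close> does not matter.\<close>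
    by (subst filterlim_sequentially_Suc[symmetric]) simp
  then have "(\<lambda>t. norm (hat_vec (X t) j - hat_vec (X (t - 1)) j)) \<longlonglongrightarrow> norm (hat_vec x j - hat_vec x j)"
    by (intro tendsto_intros lim)
  then show "\<forall>\<^sub>F t in sequentially. norm (hat_vec (X t - X (t - 1)) j) < \<tau>"
    using assms(2) j by (intro order_tendstoD(2)[where a = \<tau>]) (simp_all add: hat_vec_diff)
qed

lemma is_angle_iff: "is_angle (\<beta> :: 'k::finite circulant) \<longleftrightarrow> (\<forall>j<CARD('k). cmod (hat \<beta> j) = 1)"
proof -
  have "is_angle \<beta> \<longleftrightarrow> star \<beta> * \<beta> = 1"
    unfolding is_angle_def circ_star[symmetric] circ_times[symmetric] circ_one[symmetric]
    by (auto dest: circ_inj)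
  also have "\<dots> \<longleftrightarrow> (\<forall>j<CARD('k). cnj (hat \<beta> j) * hat \<beta> j = 1)"
    unfolding hat_eq_iff by (simp add: hat_times hat_star hat_one)
  also have "\<dots> \<longleftrightarrow> (\<forall>j<CARD('k). cmod (hat \<beta> j) = 1)"
  proof -
    have "cnj z * z = 1 \<longleftrightarrow> cmod z = 1" for z
      unfolding mult.commute[of "cnj z"] complex_norm_square[symmetric] of_real_power[symmetric]
      by (simp add: power2_eq_1_iff flip: of_real_power) (use norm_ge_zero[of z] in linarith)
    then show ?thesis by simp
  qed
  finally show ?thesis .
qed

text \<open>The factor rotates component \<open>p\<close> of the block onto the positive real
  axis.\<close>

lemma hat_vec_fix_angle:
  fixes x :: "('k::finite circulant)^'n"
  assumes "x $ p dvd 1" "j < CARD('k)"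
  shows "hat_vec (fix_angle p x) j = inverse (sgn (hat_vec x j $ p)) *s hat_vec x j"
proof -
  have "kangle (x $ p) dvd 1" using assms by (simp add: unit_iff hat_kangle)
  then show ?thesis using assms
    by (simp add: fix_angle_def hat_vec_smult hat_kinv hat_kangle hat_vec_nth sgn_eq)
qed

text \<open>\<open>fix_angle p\<close> cancels multiplication by an angle and is continuous where
  component \<open>p\<close> is a unit, so it turns convergence up to angle into literal
  convergence.\<close>

lemma kconverges_fix_angle:
  fixes x :: "('k::finite circulant)^'n"
  assumes \<beta>: "\<And>t. is_angle (\<beta> t)" and lim: "kconverges (\<lambda>t. \<beta> t *s X t) x" and p: "x $ p dvd 1"
  shows "kconverges (\<lambda>t. fix_angle p (X t)) (fix_angle p x)"
  unfolding kconverges_iff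
proof (intro allI impI)
  fix j assume j: "j < CARD('k)"
  have Y: "(\<lambda>t. hat_vec (\<beta> t *s X t) i) \<longlonglongrightarrow> hat_vec x i" if "i < CARD('k)" for i
    using lim that by (simp add: kconverges_iff)
  have nz: "hat_vec x i $ p \<noteq> 0" if "i < CARD('k)" for i
    using p that by (simp add: unit_iff hat_vec_nth)
  have "\<forall>i<CARD('k). \<forall>\<^sub>F t in sequentially. hat_vec (\<beta> t *s X t) i $ p \<noteq> 0"
    using tendsto_imp_eventually_ne[OF tendsto_vec_nth[OF Y] nz] by blast
  \<comment> \<open>The threshold must be common to all blocks: \<open>fix_angle\<close> inverts in
    the ring, where \<open>X t $ p\<close> is a unit only if every coefficient is nonzero.\<close>
  then have "\<forall>\<^sub>F t in sequentially. \<forall>i<CARD('k). hat_vec (\<beta> t *s X t) i $ p \<noteq> 0"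
    unfolding eventually_all_less .
  then have ev: "\<forall>\<^sub>F t in sequentially. inverse (sgn (hat_vec (\<beta> t *s X t) j $ p)) *s hat_vec (\<beta> t *s X t) j
      = hat_vec (fix_angle p (X t)) j"
  proof eventually_elim
    case (elim t)
    then have "X t $ p dvd 1" by (auto simp: unit_iff hat_vec_nth hat_times)
    moreover have "hat (\<beta> t) j \<noteq> 0" using \<beta>[of t] j by (auto simp: is_angle_iff)
    moreover have "sgn (hat (\<beta> t) j) = hat (\<beta> t) j" using \<beta>[of t] j by (simp add: is_angle_iff sgn_eq)
    ultimately show ?case using j
      by (simp add: hat_vec_fix_angle hat_vec_smult sgn_mult vector_smult_assoc)
  qed
  have "(\<lambda>t. inverse (sgn (hat_vec (\<beta> t *s X t) j $ p)) *s hat_vec (\<beta> t *s X t) j)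
      \<longlonglongrightarrow> inverse (sgn (hat_vec x j $ p)) *s hat_vec x j"
    using nz[OF j] by (intro tendsto_intros Y j) (simp_all add: sgn_zero_iff)
  then have "(\<lambda>t. hat_vec (fix_angle p (X t)) j) \<longlonglongrightarrow> inverse (sgn (hat_vec x j $ p)) *s hat_vec x j"
    using ev by (rule Lim_transform_eventually)
  then show "(\<lambda>t. hat_vec (fix_angle p (X t)) j) \<longlonglongrightarrow> hat_vec (fix_angle p x) j"
    using p j by (simp add: hat_vec_fix_angle)
qed

text \<open>The phases of the powers of \<open>lam 1\<close> need not settle, so convergence is
  first up to angle. Fixing the angle at \<open>p\<close> makes it literal where that component of
  the limit is a unit, and then the stopping criterion is eventually met for every
  tolerance.\<close>

theorem theorem9:
  fixes A :: "('k::finite circulant)^'n^'n"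
    and lam :: "nat \<Rightarrow> 'k circulant"
    and ev :: "nat \<Rightarrow> ('k circulant)^'n"
    and x0 :: "('k circulant)^'n"
  assumes "CARD('n) \<ge> 2"
    and "canonical_set A CARD('n) lam ev"
    and "kless (kabs (lam 2)) (kabs (lam 1))"
    and "nondeficient A (lam 1) x0"
  shows "no_breakdown A x0 \<and>
    (\<exists>x1. keigenvector A (lam 1) x1 \<and> knorm x1 = 1 \<and>
      kconverges_up_to_angle (power_iterate A x0) x1 \<and>
      (\<forall>p. x1 $ p dvd 1 \<longrightarrow>
        kconverges (\<lambda>t. fix_angle p (power_iterate A x0 t)) (fix_angle p x1) \<and>
        (\<forall>\<tau>>0. \<forall>\<^sub>F t in sequentially. stopping_criterion p \<tau> A x0 t)))"
proof -
  let ?y = "\<lambda>j t. ((*v) (hat_mat A j) ^^ t) (hat_vec x0 j)"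
  have \<mu>: "hat (lam 1) j \<noteq> 0" if "j < CARD('k)" for j
    using assms(3) that by (force simp: kless_kabs_iff)
  have v: "hat_vec x0 j \<notin> vec.span (\<Union>\<nu>\<in>- {hat (lam 1) j}. generalized_eigenspace (hat_mat A j) \<nu>)"
    if "j < CARD('k)" for j
    using assms(4) that by (simp add: nondeficient_def)
  have nz: "?y j t \<noteq> 0" if "j < CARD('k)" for j t
    by (rule power_iteration_nonzero[OF \<mu>[OF that] v[OF that]])
  note it = hat_vec_power_iterate[OF nz]
  have nb: "no_breakdown A x0"
    using nz[where t = 0] it(2) by (simp add: no_breakdown_def knorm_unit_iff)
  \<comment> \<open>One predicate for all properties lets the limits and phases be chosen for all
    blocks at once.\<close>
  define P where "P j u c \<longleftrightarrow> norm u = 1 \<and> hat_mat A j *v u = hat (lam 1) j *s u \<and>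
      (\<forall>t. cmod (c t) = 1) \<and> (\<lambda>t. c t *s sgn (?y j t)) \<longlonglongrightarrow> u" for j u c
  have "\<exists>u c. P j u c" if "j < CARD('k)" for j
    unfolding P_def
    by (rule power_iteration_direction[OF \<mu>[OF that] canonical_set_dominant[OF assms(2,1,3) that] v[OF that]])
  then obtain u c where "\<And>j. j < CARD('k) \<Longrightarrow> P j (u j) (c j)"
    by metis
  then have uc: "\<And>j. j < CARD('k) \<Longrightarrow> norm (u j) = 1"
      "\<And>j. j < CARD('k) \<Longrightarrow> hat_mat A j *v u j = hat (lam 1) j *s u j"
      "\<And>j t. j < CARD('k) \<Longrightarrow> cmod (c j t) = 1"
      "\<And>j. j < CARD('k) \<Longrightarrow> (\<lambda>t. c j t *s sgn (?y j t)) \<longlonglongrightarrow> u j"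
    unfolding P_def by blast+
  \<comment> \<open>The block limits are assembled into \<open>x1\<close> and, for each
    \<open>t\<close>, the block phases into one ring element \<open>\<beta> t\<close>.\<close>
  obtain x1 :: "('k circulant)^'n" where x1: "\<forall>j<CARD('k). hat_vec x1 j = u j"
    using hat_vec_surj by blast
  have "\<forall>t. \<exists>b :: 'k circulant. \<forall>j<CARD('k). hat b j = c j t"
    by (intro allI hat_surj)
  then obtain \<beta> :: "nat \<Rightarrow> 'k circulant" where \<beta>: "\<And>j t. j < CARD('k) \<Longrightarrow> hat (\<beta> t) j = c j t"
    by metis
  have angle: "is_angle (\<beta> t)" for t by (simp add: is_angle_iff \<beta> uc(3))
  have conv: "kconverges (\<lambda>t. \<beta> t *s power_iterate A x0 t) x1"
    unfolding kconverges_iff using uc(4) by (simp add: hat_vec_smult it(1) \<beta> x1)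
  have "keigenvalue A (lam 1)"
    using assms(1,2) unfolding canonical_set_def reproduces_def keigenvector_def by auto
  moreover have "A *v x1 = lam 1 *s x1"
    by (rule hat_vec_inj) (simp add: hat_vec_mult hat_vec_smult x1 uc(2))
  moreover have "hat_vec x1 j \<noteq> 0" if "j < CARD('k)" for j
    using uc(1)[OF that] x1 that by force
  ultimately have "keigenvector A (lam 1) x1" by (simp add: keigenvector_def)
  moreover have "knorm x1 = 1"
    by (rule hat_inj) (simp add: hat_knorm hat_one x1 uc(1))
  moreover have "kconverges_up_to_angle (power_iterate A x0) x1"
    using angle conv unfolding kconverges_up_to_angle_def by blast
  moreover have "kconverges (\<lambda>t. fix_angle p (power_iterate A x0 t)) (fix_angle p x1) \<and>
      (\<forall>\<tau>>0. \<forall>\<^sub>F t in sequentially. stopping_criterion p \<tau> A x0 t)" if "x1 $ p dvd 1" for p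
    using kconverges_fix_angle[OF angle conv that] kconverges_successive
    unfolding stopping_criterion_def by blast
  ultimately show ?thesis using nb by blast
qed

end
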